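(* Let $(M,g,\nabla,\nabla^{*},\Theta)$ be a $\Theta$-statistical manifold. Then, for every piecewise smooth curve $\gamma:[a,b]\to M$ and every $s,t\in[a,b]$, \[ \mathcal{P}^{\nabla}_{\gamma;s,t}\circ\Theta_{\gamma(s)} = \Theta_{\gamma(t)}\circ\mathcal{P}^{\nabla^{*}}_{\gamma;s,t}. \]
   Context: A statistical manifold $(M,g,\nabla,\nabla^{*})$ is a Riemannian manifold $(M,g)$ with two torsion-free affine connections $\nabla,\nabla^{*}$ that are dual with respect to $g$: $Xg(Y,Z)=g(\nabla_XY,Z)+g(Y,\nabla_X^{*}Z)$ for all vector fields $X,Y,Z$. A nonzero $(1,1)$-tensor field $\Theta$ on $M$ is a statistical gauge tensor if it satisfies the gauge equation $\nabla_X(\Theta Y)=\Theta(\nabla_X^{*}Y)$ for all $X,Y\in\Gamma(TM)$; then $(M,g,\nabla,\nabla^{*},\Theta)$ is called a $\Theta$-statistical manifold. For a piecewise smooth curve $\gamma:[a,b]\to M$ and $s,t\in[a,b]$, $\mathcal{P}^{\nabla}_{\gamma;s,t},\ \mathcal{P}^{\nabla^{*}}_{\gamma;s,t}:T_{\gamma(s)}M\to T_{\gamma(t)}M$ denote the parallel transport maps along $\gamma$ with respect to $\nabla$ and $\nabla^{*}$, respectively. *)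

theory Defs
  imports "HOL-Analysis.Analysis" "HOL-Library.Function_Algebras"
begin

section \<open>Smooth maps between Euclidean spaces\<close>

text \<open>For open \<open>S\<close> in a finite-dimensional space, \<open>Ck_on k S f\<close> says that \<open>f\<close> is of class
  \<open>C\<^sup>k\<close> on \<open>S\<close>: the total derivative is of class \<open>C\<^sup>k\<close> iff its value at every fixed direction is.\<close>

primrec Ck_on :: "nat \<Rightarrow> 'a::euclidean_space set \<Rightarrow> ('a \<Rightarrow> 'b::euclidean_space) \<Rightarrow> bool" where
  "Ck_on 0 S f \<longleftrightarrow> continuous_on S f"
| "Ck_on (Suc k) S f \<longleftrightarrow>
     (\<forall>x\<in>S. f differentiable (at x)) \<and> (\<forall>v. Ck_on k S (\<lambda>x. frechet_derivative f (at x) v))"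

text \<open>On an arbitrary set, smooth means locally the restriction of a \<open>C\<^sup>\<infinity>\<close> map on an open set.
  This is needed for curves on closed intervals; for open \<open>S\<close> it is the usual notion.\<close>

definition smooth_on :: "'a::euclidean_space set \<Rightarrow> ('a \<Rightarrow> 'b::euclidean_space) \<Rightarrow> bool" where
  "smooth_on S f \<longleftrightarrow>
     (\<forall>x\<in>S. \<exists>U h. open U \<and> x \<in> U \<and> (\<forall>k. Ck_on k U h) \<and> (\<forall>y\<in>S \<inter> U. h y = f y))"


section \<open>Smooth manifolds\<close>

text \<open>A manifold is a whole type \<open>'m\<close> (Hausdorff and second countable by its type classes) with
  an atlas of charts into the Euclidean space \<open>'e\<close>. A chart is a domain with a map that is only
  relevant on that domain. The atlas need not be maximal: everything below depends only on the
  smooth structure it generates. Since the dimension of \<open>'e\<close> is positive,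
  \<open>0\<close>-dimensional manifolds are excluded; they carry no nonzero \<open>(1,1)\<close>-tensor field.\<close>

type_synonym ('m, 'e) chart = "'m set \<times> ('m \<Rightarrow> 'e)"

definition smooth_manifold ::
  "('m::{t2_space, second_countable_topology}, 'e::euclidean_space) chart set \<Rightarrow> bool" where
  "smooth_manifold A \<longleftrightarrow>
     (\<Union>(U, \<phi>)\<in>A. U) = UNIV \<and>
     (\<forall>(U, \<phi>)\<in>A. open U \<and> open (\<phi> ` U) \<and> homeomorphism U (\<phi> ` U) \<phi> (inv_into U \<phi>)) \<and>
     (\<forall>(U, \<phi>)\<in>A. \<forall>(W, \<psi>)\<in>A. smooth_on (\<phi> ` (U \<inter> W)) (\<psi> \<circ> inv_into U \<phi>))"

definition smooth_functions ::
  "('m::{t2_space, second_countable_topology}, 'e::euclidean_space) chart set \<Rightarrow> ('m \<Rightarrow> real) set" where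
  "smooth_functions A = {u. \<forall>(U, \<phi>)\<in>A. smooth_on (\<phi> ` U) (u \<circ> inv_into U \<phi>)}"

definition smooth_curve_on ::
  "('m::{t2_space, second_countable_topology}, 'e::euclidean_space) chart set \<Rightarrow> real set \<Rightarrow> (real \<Rightarrow> 'm) \<Rightarrow> bool" where
  "smooth_curve_on A S \<gamma> \<longleftrightarrow>
     continuous_on S \<gamma> \<and> (\<forall>(U, \<phi>)\<in>A. smooth_on {t\<in>S. \<gamma> t \<in> U} (\<phi> \<circ> \<gamma>))"


section \<open>Tangent vectors and vector fields\<close>

text \<open>A tangent vector at \<open>p\<close> is the directional derivative \<open>u \<mapsto> (u \<circ> \<gamma>)'(0)\<close> along a smooth
  curve \<open>\<gamma>\<close> through \<open>p\<close>, as an operator on \<open>C\<^sup>\<infinity>(M)\<close>. The value \<open>0\<close> on non-smooth functions is a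
  convention that makes equality of tangent vectors equality of HOL functions. Addition and zero
  of tangent vectors and vector fields are pointwise.\<close>

type_synonym 'm tvec = "('m \<Rightarrow> real) \<Rightarrow> real"
type_synonym 'm vfield = "'m \<Rightarrow> 'm tvec"

text \<open>The interval \<open>S\<close> is a parameter so that at its endpoints the velocity is one-sided.\<close>

definition velocity ::
  "('m::{t2_space, second_countable_topology}, 'e::euclidean_space) chart set \<Rightarrow> real set \<Rightarrow> (real \<Rightarrow> 'm) \<Rightarrow> real \<Rightarrow> 'm tvec" where
  "velocity A S \<gamma> t =
     (\<lambda>u. if u \<in> smooth_functions A then vector_derivative (u \<circ> \<gamma>) (at t within S) else 0)"

definition tangent_space ::
  "('m::{t2_space, second_countable_topology}, 'e::euclidean_space) chart set \<Rightarrow> 'm \<Rightarrow> 'm tvec set" where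
  "tangent_space A p =
     {velocity A {-\<epsilon><..<\<epsilon>} \<gamma> 0 | \<epsilon> \<gamma>. \<epsilon> > 0 \<and> smooth_curve_on A {-\<epsilon><..<\<epsilon>} \<gamma> \<and> \<gamma> 0 = p}"

definition tscale :: "real \<Rightarrow> 'm tvec \<Rightarrow> 'm tvec" (infixr "*\<^sub>T" 75) where
  "r *\<^sub>T v = (\<lambda>u. r * v u)"

definition fscale :: "('m \<Rightarrow> real) \<Rightarrow> 'm vfield \<Rightarrow> 'm vfield" (infixr "*\<^sub>F" 75) where
  "h *\<^sub>F X = (\<lambda>p. h p *\<^sub>T X p)"

definition act :: "'m vfield \<Rightarrow> ('m \<Rightarrow> real) \<Rightarrow> ('m \<Rightarrow> real)" where
  "act X u = (\<lambda>p. X p u)"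

definition vector_fields ::
  "('m::{t2_space, second_countable_topology}, 'e::euclidean_space) chart set \<Rightarrow> 'm vfield set" where
  "vector_fields A =
     {X. (\<forall>p. X p \<in> tangent_space A p) \<and>
         (\<forall>u\<in>smooth_functions A. act X u \<in> smooth_functions A)}"

definition lie_bracket :: "'m vfield \<Rightarrow> 'm vfield \<Rightarrow> 'm vfield" where
  "lie_bracket X Y = (\<lambda>p u. X p (act Y u) - Y p (act X u))"


section \<open>Metrics, connections and \<open>(1,1)\<close>-tensor fields\<close>

type_synonym 'm metric_tensor = "'m \<Rightarrow> 'm tvec \<Rightarrow> 'm tvec \<Rightarrow> real"
type_synonym 'm connection = "'m vfield \<Rightarrow> 'm vfield \<Rightarrow> 'm vfield"
type_synonym 'm tensor11 = "'m \<Rightarrow> 'm tvec \<Rightarrow> 'm tvec"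

definition riemannian_metric ::
  "('m::{t2_space, second_countable_topology}, 'e::euclidean_space) chart set \<Rightarrow> 'm metric_tensor \<Rightarrow> bool" where
  "riemannian_metric A g \<longleftrightarrow>
     (\<forall>p. \<forall>v\<in>tangent_space A p. \<forall>w\<in>tangent_space A p.
        g p v w = g p w v \<and>
        (\<forall>z\<in>tangent_space A p. \<forall>r. g p (v + z) w = g p v w + g p z w \<and>
                                     g p (r *\<^sub>T v) w = r * g p v w) \<and>
        (v \<noteq> 0 \<longrightarrow> g p v v > 0)) \<and>
     (\<forall>X\<in>vector_fields A. \<forall>Y\<in>vector_fields A. (\<lambda>p. g p (X p) (Y p)) \<in> smooth_functions A)"

definition affine_connection ::
  "('m::{t2_space, second_countable_topology}, 'e::euclidean_space) chart set \<Rightarrow> 'm connection \<Rightarrow> bool" where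
  "affine_connection A D \<longleftrightarrow>
     (\<forall>X\<in>vector_fields A. \<forall>Y\<in>vector_fields A. D X Y \<in> vector_fields A) \<and>
     (\<forall>X\<in>vector_fields A. \<forall>Z\<in>vector_fields A. \<forall>Y\<in>vector_fields A.
        D (X + Z) Y = D X Y + D Z Y \<and> D Y (X + Z) = D Y X + D Y Z) \<and>
     (\<forall>h\<in>smooth_functions A. \<forall>X\<in>vector_fields A. \<forall>Y\<in>vector_fields A.
        D (h *\<^sub>F X) Y = h *\<^sub>F D X Y \<and>
        D X (h *\<^sub>F Y) = act X h *\<^sub>F Y + h *\<^sub>F D X Y)"

definition torsion_free ::
  "('m::{t2_space, second_countable_topology}, 'e::euclidean_space) chart set \<Rightarrow> 'm connection \<Rightarrow> bool" where
  "torsion_free A D \<longleftrightarrow>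
     (\<forall>X\<in>vector_fields A. \<forall>Y\<in>vector_fields A. D X Y - D Y X = lie_bracket X Y)"

definition dual_connections ::
  "('m::{t2_space, second_countable_topology}, 'e::euclidean_space) chart set \<Rightarrow> 'm metric_tensor \<Rightarrow>
   'm connection \<Rightarrow> 'm connection \<Rightarrow> bool" where
  "dual_connections A g D Ds \<longleftrightarrow>
     (\<forall>X\<in>vector_fields A. \<forall>Y\<in>vector_fields A. \<forall>Z\<in>vector_fields A.
        act X (\<lambda>p. g p (Y p) (Z p)) =
        (\<lambda>p. g p (D X Y p) (Z p) + g p (Y p) (Ds X Z p)))"

definition statistical_manifold ::
  "('m::{t2_space, second_countable_topology}, 'e::euclidean_space) chart set \<Rightarrow> 'm metric_tensor \<Rightarrow>
   'm connection \<Rightarrow> 'm connection \<Rightarrow> bool" where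
  "statistical_manifold A g D Ds \<longleftrightarrow>
     smooth_manifold A \<and> riemannian_metric A g \<and>
     affine_connection A D \<and> torsion_free A D \<and>
     affine_connection A Ds \<and> torsion_free A Ds \<and>
     dual_connections A g D Ds"

definition tapply :: "'m tensor11 \<Rightarrow> 'm vfield \<Rightarrow> 'm vfield" where
  "tapply \<Theta> X = (\<lambda>p. \<Theta> p (X p))"

definition tensor_field11 ::
  "('m::{t2_space, second_countable_topology}, 'e::euclidean_space) chart set \<Rightarrow> 'm tensor11 \<Rightarrow> bool" where
  "tensor_field11 A \<Theta> \<longleftrightarrow>
     (\<forall>p. \<forall>v\<in>tangent_space A p. \<Theta> p v \<in> tangent_space A p \<and>
        (\<forall>w\<in>tangent_space A p. \<Theta> p (v + w) = \<Theta> p v + \<Theta> p w) \<and>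
        (\<forall>r. \<Theta> p (r *\<^sub>T v) = r *\<^sub>T \<Theta> p v)) \<and>
     (\<forall>X\<in>vector_fields A. tapply \<Theta> X \<in> vector_fields A)"

definition statistical_gauge_tensor ::
  "('m::{t2_space, second_countable_topology}, 'e::euclidean_space) chart set \<Rightarrow>
   'm connection \<Rightarrow> 'm connection \<Rightarrow> 'm tensor11 \<Rightarrow> bool" where
  "statistical_gauge_tensor A D Ds \<Theta> \<longleftrightarrow>
     tensor_field11 A \<Theta> \<and>
     (\<exists>p. \<exists>v\<in>tangent_space A p. \<Theta> p v \<noteq> 0) \<and>
     (\<forall>X\<in>vector_fields A. \<forall>Y\<in>vector_fields A. D X (tapply \<Theta> Y) = tapply \<Theta> (Ds X Y))"

definition theta_statistical_manifold ::
  "('m::{t2_space, second_countable_topology}, 'e::euclidean_space) chart set \<Rightarrow> 'm metric_tensor \<Rightarrow>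
   'm connection \<Rightarrow> 'm connection \<Rightarrow> 'm tensor11 \<Rightarrow> bool" where
  "theta_statistical_manifold A g D Ds \<Theta> \<longleftrightarrow>
     statistical_manifold A g D Ds \<and> statistical_gauge_tensor A D Ds \<Theta>"


section \<open>Parallel transport\<close>

definition smooth_partition ::
  "('m::{t2_space, second_countable_topology}, 'e::euclidean_space) chart set \<Rightarrow> real \<Rightarrow> real \<Rightarrow>
   (real \<Rightarrow> 'm) \<Rightarrow> nat \<Rightarrow> (nat \<Rightarrow> real) \<Rightarrow> bool" where
  "smooth_partition A a b \<gamma> n \<tau> \<longleftrightarrow>
     \<tau> 0 = a \<and> \<tau> n = b \<and>
     (\<forall>i<n. \<tau> i < \<tau> (Suc i) \<and> smooth_curve_on A {\<tau> i..\<tau> (Suc i)} \<gamma>)"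

definition piecewise_smooth_curve ::
  "('m::{t2_space, second_countable_topology}, 'e::euclidean_space) chart set \<Rightarrow> real \<Rightarrow> real \<Rightarrow>
   (real \<Rightarrow> 'm) \<Rightarrow> bool" where
  "piecewise_smooth_curve A a b \<gamma> \<longleftrightarrow>
     a < b \<and> continuous_on {a..b} \<gamma> \<and> (\<exists>n \<tau>. smooth_partition A a b \<gamma> n \<tau>)"

text \<open>\<open>has_covariant_derivative A D S \<gamma> V w t\<close>: the field \<open>V\<close> along \<open>\<gamma>\<close> has the covariant
  derivative \<open>w\<close> at \<open>t \<in> S\<close>, where \<open>\<gamma>\<close> is smooth on the interval \<open>S\<close>. This is the operator
  determined by additivity, the product rule and \<open>D\<^sub>t (Y \<circ> \<gamma>) = \<nabla>\<^bsub>\<gamma>'\<^esub> Y\<close>: near \<open>t\<close> write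
  \<open>V = (\<Sum>i<n. f\<^sub>i (Y\<^sub>i \<circ> \<gamma>))\<close> with vector fields \<open>Y\<^sub>i\<close> on \<open>M\<close>; then
  \<open>D\<^sub>t V = (\<Sum>i<n. f\<^sub>i' (Y\<^sub>i \<circ> \<gamma>) + f\<^sub>i \<nabla>\<^bsub>\<gamma>'\<^esub> Y\<^sub>i)\<close>, which does not depend on the representation.
  Every differentiable field along \<open>\<gamma>\<close> has such a representation, by a local frame. As \<open>D\<close> acts
  on vector fields, the velocity of \<open>\<gamma>\<close> at \<open>t\<close> enters through an extension \<open>X\<close>.\<close>

definition has_covariant_derivative ::
  "('m::{t2_space, second_countable_topology}, 'e::euclidean_space) chart set \<Rightarrow> 'm connection \<Rightarrow>
   real set \<Rightarrow> (real \<Rightarrow> 'm) \<Rightarrow> (real \<Rightarrow> 'm tvec) \<Rightarrow> 'm tvec \<Rightarrow> real \<Rightarrow> bool" where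
  "has_covariant_derivative A D S \<gamma> V w t \<longleftrightarrow>
     (\<exists>(n::nat) Y f f' X.
        (\<forall>i<n. Y i \<in> vector_fields A \<and> (f i has_real_derivative f' i) (at t within S)) \<and>
        (\<exists>\<epsilon>>0. \<forall>s\<in>S. \<bar>s - t\<bar> < \<epsilon> \<longrightarrow> V s = (\<Sum>i<n. f i s *\<^sub>T Y i (\<gamma> s))) \<and>
        X \<in> vector_fields A \<and> X (\<gamma> t) = velocity A S \<gamma> t \<and>
        w = (\<Sum>i<n. f' i *\<^sub>T Y i (\<gamma> t) + f i t *\<^sub>T D X (Y i) (\<gamma> t)))"

text \<open>Parallel fields are differentiable on each closed smooth piece (one-sidedly at its ends)
  and single-valued at the break points, hence continuous. Smoothness on each
  piece need not be demanded, since solutions of the linear equation \<open>D\<^sub>t V = 0\<close> are smooth.\<close>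

definition parallel_along ::
  "('m::{t2_space, second_countable_topology}, 'e::euclidean_space) chart set \<Rightarrow> 'm connection \<Rightarrow>
   real \<Rightarrow> real \<Rightarrow> (real \<Rightarrow> 'm) \<Rightarrow> (real \<Rightarrow> 'm tvec) \<Rightarrow> bool" where
  "parallel_along A D a b \<gamma> V \<longleftrightarrow>
     (\<exists>n \<tau>. smooth_partition A a b \<gamma> n \<tau> \<and>
        (\<forall>i<n. \<forall>t\<in>{\<tau> i..\<tau> (Suc i)}. has_covariant_derivative A D {\<tau> i..\<tau> (Suc i)} \<gamma> V 0 t))"

definition parallel_transport ::
  "('m::{t2_space, second_countable_topology}, 'e::euclidean_space) chart set \<Rightarrow> 'm connection \<Rightarrow>
   real \<Rightarrow> real \<Rightarrow> (real \<Rightarrow> 'm) \<Rightarrow> real \<Rightarrow> real \<Rightarrow> 'm tvec \<Rightarrow> 'm tvec" where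
  "parallel_transport A D a b \<gamma> s t v = (THE w. \<exists>V. parallel_along A D a b \<gamma> V \<and> V s = v \<and> V t = w)"

end

theory Submission
  imports Defs "HOL-Computational_Algebra.Polynomial"
begin

text \<open>If \<open>V\<close> is a \<open>\<nabla>\<^sup>*\<close>-parallel field along \<open>\<gamma>\<close>, then \<open>\<Theta>V\<close> is \<open>\<nabla>\<close>-parallel: write
\<open>V = \<Sum> f\<^sub>i (Y\<^sub>i \<circ> \<gamma>)\<close> near a parameter; since \<open>\<Theta>\<close> is linear, \<open>\<Theta>V = \<Sum> f\<^sub>i (\<Theta>Y\<^sub>i \<circ> \<gamma>)\<close>, and the
gauge equation \<open>\<nabla>\<^sub>X(\<Theta>Y\<^sub>i) = \<Theta>(\<nabla>\<^sup>*\<^sub>X Y\<^sub>i)\<close> turns the covariant derivative of \<open>\<Theta>V\<close> into \<open>\<Theta>\<close> of that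
of \<open>V\<close> (lemma \<open>gauge_covariant_derivative\<close>). So if \<open>V\<close> starts at \<open>v\<close> at time \<open>s\<close>, then \<open>\<Theta>V\<close> starts
at \<open>\<Theta>v\<close>, and both sides of the claim are the value of \<open>\<Theta>V\<close> at time \<open>t\<close>.

This argument needs parallel transport to be a well-defined map, for both connections: through every
tangent vector passes a parallel field, and two parallel fields that agree at one time agree at all
times. Transport is a definite description, so both facts are indispensable.

Existence (\<open>transportable_piecewise_smooth\<close>). In a local frame of globally defined vector fields,
which bump functions provide, the equation for a parallel field is a linear ordinary differential
equation with continuous coefficients; a contraction argument solves it on short intervals from any
initial time. As a parallel field is required to be differentiable only on the pieces of some
partition, solutions on adjacent short intervals can be joined as soon as their values match, and
Bolzano's bisection principle does the rest.

Uniqueness (\<open>parallel_unique\<close>). Duality gives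
\<open>d/dt g(V, W) = g(\<nabla>\<^sub>t V, W) + g(V, \<nabla>\<^sup>*\<^sub>t W)\<close>, so the product of a \<open>\<nabla>\<close>-parallel and a
\<open>\<nabla>\<^sup>*\<close>-parallel field is constant. By existence for \<open>\<nabla>\<^sup>*\<close>, every tangent vector at time \<open>t\<close> is the
value of some \<open>\<nabla>\<^sup>*\<close>-parallel \<open>W\<close>; hence the value of \<open>V\<close> at \<open>s\<close> determines all products with
\<open>V\<close> at \<open>t\<close>, and positive definiteness determines \<open>V\<close> at \<open>t\<close>. In this way uniqueness follows from
existence for the dual connection, and the product rule along the curve is the only place where the
representations \<open>\<Sum> f\<^sub>i (Y\<^sub>i \<circ> \<gamma>)\<close> of two different fields meet.\<close>

section \<open>Differentiable functions of class \<open>C\<^sup>k\<close>\<close>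

lemma Ck_on_subset:
  "Ck_on k S f \<Longrightarrow> T \<subseteq> S \<Longrightarrow> Ck_on k T f"
  by (induction k arbitrary: f) (auto intro: continuous_on_subset)

lemma Ck_on_cong:
  assumes "open S" and "\<And>x. x \<in> S \<Longrightarrow> f x = h x" and "Ck_on k S f"
  shows "Ck_on k S h"
  using assms(2,3)
proof (induction k arbitrary: f h)
  case 0
  then show ?case by (auto cong: continuous_on_cong)
next
  case (Suc k)
  have D: "(h has_derivative frechet_derivative f (at x)) (at x)" if "x \<in> S" for x
    using Suc.prems that assms(1)
    by (auto intro!: has_derivative_transform_within_open[of f _ x UNIV S h]
        simp: frechet_derivative_works)
  have "frechet_derivative f (at x) v = frechet_derivative h (at x) v" if "x \<in> S" for x v
    using frechet_derivative_at[OF D[OF that]] by simp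
  then have "Ck_on k S (\<lambda>x. frechet_derivative h (at x) v)" for v
    using Suc.IH[of "\<lambda>x. frechet_derivative f (at x) v"] Suc.prems by simp
  with D show ?case
    by (auto simp: differentiable_def)
qed

lemma Ck_on_local:
  assumes "\<And>x. x \<in> S \<Longrightarrow> \<exists>U. open U \<and> x \<in> U \<and> Ck_on k U f"
  shows "Ck_on k S f"
  using assms
proof (induction k arbitrary: f)
  case 0
  have "isCont f x" if "x \<in> S" for x
    using 0[OF that] by (auto simp: continuous_on_eq_continuous_at)
  then show ?case by (simp add: continuous_at_imp_continuous_on)
next
  case (Suc k)
  show ?case
    unfolding Ck_on.simps
  proof (intro conjI ballI allI)
    show "f differentiable at x" if "x \<in> S" for x
      using Suc.prems[OF that] by auto
    show "Ck_on k S (\<lambda>x. frechet_derivative f (at x) v)" for v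
      using Suc.prems by (intro Suc.IH) fastforce
  qed
qed

lemma Ck_on_Suc_D:
  "Ck_on (Suc k) S f \<Longrightarrow> Ck_on k S f"
proof (induction k arbitrary: f)
  case 0
  then show ?case
    by (auto intro!: continuous_at_imp_continuous_on differentiable_imp_continuous_within)
qed simp

lemma Ck_on_SucI:
  assumes "open S" and D: "\<And>x. x \<in> S \<Longrightarrow> (f has_derivative f' x) (at x)"
    and "\<And>v. Ck_on k S (\<lambda>x. f' x v)"
  shows "Ck_on (Suc k) S f"
proof -
  have "Ck_on k S (\<lambda>x. frechet_derivative f (at x) v)" for v
    by (rule Ck_on_cong[OF assms(1) _ assms(3)[of v]]) (simp add: frechet_derivative_at[OF D])
  then show ?thesis
    using D by (auto simp: differentiable_def)
qed

lemma Ck_on_const: "open S \<Longrightarrow> Ck_on k S (\<lambda>x. c)"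
  by (induction k arbitrary: c) (auto intro!: Ck_on_SucI[where f' = "\<lambda>_ _. 0"] simp del: Ck_on.simps(2))

lemma Ck_on_linear_compose:
  assumes "open S" "bounded_linear L"
  shows "Ck_on k S f \<Longrightarrow> Ck_on k S (\<lambda>x. L (f x))"
proof (induction k arbitrary: f)
  case 0
  then show ?case
    using bounded_linear.continuous_on[OF assms(2)] by simp
next
  case (Suc k)
  then show ?case
    by (intro Ck_on_SucI[OF assms(1), where f' = "\<lambda>x v. L (frechet_derivative f (at x) v)"])
       (auto simp: frechet_derivative_works intro!: bounded_linear.has_derivative[OF assms(2)])
qed

lemma Ck_on_linear:
  assumes "open S" "bounded_linear L"
  shows "Ck_on k S L"
  using assms(1,2) bounded_linear_imp_has_derivative[OF assms(2)]
  by (cases k) (auto intro!: Ck_on_SucI[where f' = "\<lambda>_. L"] Ck_on_const linear_continuous_on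
     simp del: Ck_on.simps(2))

lemma Ck_on_add:
  assumes "open S"
  shows "Ck_on k S f \<Longrightarrow> Ck_on k S h \<Longrightarrow> Ck_on k S (\<lambda>x. f x + h x)"
proof (induction k arbitrary: f h)
  case (Suc k)
  then show ?case
    by (intro Ck_on_SucI[OF assms,
          where f' = "\<lambda>x v. frechet_derivative f (at x) v + frechet_derivative h (at x) v"])
       (auto simp: frechet_derivative_works intro!: has_derivative_add)
qed (auto intro: continuous_intros)

lemma Ck_on_sum:
  assumes "open S" "\<And>i. i \<in> I \<Longrightarrow> Ck_on k S (f i)"
  shows "Ck_on k S (\<lambda>x. \<Sum>i\<in>I. f i x)"
  using assms(2)
  by (induction I rule: infinite_finite_induct) (auto intro: Ck_on_const Ck_on_add assms(1))

lemma Ck_on_scaleR: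
  fixes f :: "'a::euclidean_space \<Rightarrow> real" and h :: "'a \<Rightarrow> 'b::euclidean_space"
  assumes "open S"
  shows "Ck_on k S f \<Longrightarrow> Ck_on k S h \<Longrightarrow> Ck_on k S (\<lambda>x. f x *\<^sub>R h x)"
proof (induction k arbitrary: f h)
  case (Suc k)
  show ?case
  proof (rule Ck_on_SucI[OF assms])
    show "((\<lambda>x. f x *\<^sub>R h x) has_derivative
       (\<lambda>v. f x *\<^sub>R frechet_derivative h (at x) v + frechet_derivative f (at x) v *\<^sub>R h x)) (at x)"
      if "x \<in> S" for x
      using that Suc.prems by (auto intro!: has_derivative_scaleR simp: frechet_derivative_works)
    show "Ck_on k S (\<lambda>x. f x *\<^sub>R frechet_derivative h (at x) v + frechet_derivative f (at x) v *\<^sub>R h x)" for v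
      using Suc.prems Suc.prems[THEN Ck_on_Suc_D]
      by (auto intro!: Ck_on_add[OF assms] Suc.IH)
  qed
qed (auto intro: continuous_intros)

text \<open>In coordinates the chain rule reads \<open>D(h \<circ> f) v = \<Sum>\<^sub>b (D f v \<bullet> b) (D h b \<circ> f)\<close>, summed over an
orthonormal basis. Every factor is of class \<open>C\<^sup>k\<close> by induction, which closes the step to
\<open>k + 1\<close>.\<close>

lemma Ck_on_compose:
  fixes f :: "'a::euclidean_space \<Rightarrow> 'b::euclidean_space" and h :: "'b \<Rightarrow> 'c::euclidean_space"
  assumes "open S" "open T" and im: "f ` S \<subseteq> T"
  shows "Ck_on k S f \<Longrightarrow> Ck_on k T h \<Longrightarrow> Ck_on k S (\<lambda>x. h (f x))"
proof (induction k arbitrary: h)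
  case 0
  then show ?case
    using im by (auto intro: continuous_on_compose2)
next
  case (Suc k)
  let ?f = "\<lambda>x. frechet_derivative f (at x)" and ?h = "\<lambda>y. frechet_derivative h (at y)"
  have h: "(h has_derivative ?h (f x)) (at (f x))" if "x \<in> S" for x
    using that Suc.prems im by (auto simp: frechet_derivative_works)
  have expand: "?h (f x) (?f x v) = (\<Sum>b\<in>Basis. (?f x v \<bullet> b) *\<^sub>R ?h (f x) b)" if "x \<in> S" for x v
  proof -
    have lin: "linear (?h (f x))"
      using h[OF that] by (simp add: has_derivative_linear)
    have "?h (f x) (?f x v) = ?h (f x) (\<Sum>b\<in>Basis. (?f x v \<bullet> b) *\<^sub>R b)"
      by (simp add: euclidean_representation)
    then show ?thesis
      by (simp add: linear_sum[OF lin] linear_cmul[OF lin])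
  qed
  show ?case
  proof (rule Ck_on_SucI[OF assms(1)])
    show "((\<lambda>x. h (f x)) has_derivative (\<lambda>v. ?h (f x) (?f x v))) (at x)" if "x \<in> S" for x
      using that Suc.prems h[OF that]
      by (intro has_derivative_compose[of f "?f x" x UNIV h]) (auto simp: frechet_derivative_works)
    fix v
    have "Ck_on k S (\<lambda>x. \<Sum>b\<in>Basis. (?f x v \<bullet> b) *\<^sub>R ?h (f x) b)"
      using Suc.prems Ck_on_Suc_D[OF Suc.prems(1)]
      by (intro Ck_on_sum Ck_on_scaleR Suc.IH Ck_on_linear_compose[OF assms(1), where L = "\<lambda>y. y \<bullet> _"])
         (auto intro: bounded_linear_inner_left assms(1))
    then show "Ck_on k S (\<lambda>x. ?h (f x) (?f x v))"
      by (rule Ck_on_cong[OF assms(1), rotated]) (simp add: expand)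
  qed
qed

text \<open>On an open set the local extensions in the definition of smoothness agree with the function, so the
calculus for a fixed class \<open>C\<^sup>k\<close> applies directly.\<close>

lemma smooth_on_open:
  assumes "open S"
  shows "smooth_on S f \<longleftrightarrow> (\<forall>k. Ck_on k S f)"
proof
  assume L: "smooth_on S f"
  show "\<forall>k. Ck_on k S f"
  proof (intro allI Ck_on_local)
    fix k x assume "x \<in> S"
    then have "\<exists>U h. open U \<and> x \<in> U \<and> (\<forall>k. Ck_on k U h) \<and> (\<forall>y\<in>S \<inter> U. h y = f y)"
      using L by (simp add: smooth_on_def)
    then obtain U h where U: "open U" "x \<in> U" "\<forall>k. Ck_on k U h" "\<forall>y\<in>S \<inter> U. h y = f y"
      by (elim exE conjE)
    have "Ck_on k (S \<inter> U) f"
      using U(3) U(4) open_Int[OF assms U(1)]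
      by (intro Ck_on_cong[of "S \<inter> U" h f] Ck_on_subset[of k U h "S \<inter> U"]) blast+
    moreover have "open (S \<inter> U)"
      using U assms by blast
    ultimately show "\<exists>U. open U \<and> x \<in> U \<and> Ck_on k U f"
      using \<open>x \<in> S\<close> U(2) by blast
  qed
next
  assume "\<forall>k. Ck_on k S f"
  with assms show "smooth_on S f"
    unfolding smooth_on_def by blast
qed

lemma smooth_on_subset:
  assumes "smooth_on S f" and "T \<subseteq> S"
  shows "smooth_on T f"
  unfolding smooth_on_def
proof
  fix x assume "x \<in> T"
  then have "\<exists>U h. open U \<and> x \<in> U \<and> (\<forall>k. Ck_on k U h) \<and> (\<forall>y\<in>S \<inter> U. h y = f y)"
    using assms by (auto simp: smooth_on_def)
  then obtain U h where "open U \<and> x \<in> U \<and> (\<forall>k. Ck_on k U h) \<and> (\<forall>y\<in>S \<inter> U. h y = f y)"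
    by (elim exE)
  then show "\<exists>U h. open U \<and> x \<in> U \<and> (\<forall>k. Ck_on k U h) \<and> (\<forall>y\<in>T \<inter> U. h y = f y)"
    using assms(2) by (intro exI[of _ U] exI[of _ h]) auto
qed

section \<open>Bump functions on Euclidean space\<close>

text \<open>The functions \<open>p(1/t) e\<^bsup>-1/t\<^esup>\<close>, extended by \<open>0\<close> to \<open>t \<le> 0\<close>. Allowing all polynomials \<open>p\<close> makes the
family closed under differentiation, so smoothness of \<open>e\<^bsup>-1/t\<^esup>\<close> (the case \<open>p = 1\<close>) becomes an
induction on the order of the derivative.\<close>

definition flat_exp :: "real poly \<Rightarrow> real \<Rightarrow> real" where
  "flat_exp p t = (if t > 0 then poly p (inverse t) * exp (- inverse t) else 0)"

lemma poly_times_exp_minus_tendsto_0: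
  "((\<lambda>x::real. poly p x * exp (- x)) \<longlongrightarrow> 0) at_top"
proof -
  have "((\<lambda>x::real. \<Sum>i\<le>degree p. coeff p i * (x ^ i / exp x)) \<longlongrightarrow> (\<Sum>i\<le>degree p. coeff p i * 0)) at_top"
    by (intro tendsto_sum tendsto_mult tendsto_const tendsto_power_div_exp_0)
  moreover have "poly p x * exp (- x) = (\<Sum>i\<le>degree p. coeff p i * (x ^ i / exp x))" for x
  proof -
    have "coeff p i * x ^ i * exp (- x) = coeff p i * (x ^ i / exp x)" for i
      by (simp add: exp_minus field_simps)
    then show ?thesis
      by (simp only: poly_altdef sum_distrib_right)
  qed
  ultimately show ?thesis
    by simp
qed

text \<open>For \<open>t > 0\<close> this is the product rule, for \<open>t < 0\<close> the function vanishes locally, and at \<open>0\<close>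
the difference quotient from the right is \<open>x p(x) e\<^bsup>-x\<^esup>\<close> at \<open>x = 1/t \<rightarrow> \<infinity>\<close>.\<close>

lemma flat_exp_has_derivative:
  "(flat_exp p has_real_derivative flat_exp ((p - pderiv p) * [:0, 0, 1:]) t) (at t)"
proof -
  consider "t > 0" | "t < 0" | "t = 0" by linarith
  then show ?thesis
  proof cases
    case 1
    have P: "((\<lambda>t. poly p (inverse t)) has_real_derivative
        poly (pderiv p) (inverse t) * - (inverse t ^ Suc (Suc 0))) (at t)"
      using 1 by (intro DERIV_chain2[of "poly p"] poly_DERIV DERIV_inverse) simp
    have E: "((\<lambda>t. exp (- inverse t)) has_real_derivative
        exp (- inverse t) * - (- (inverse t ^ Suc (Suc 0)))) (at t)"
      using 1 by (intro DERIV_chain2[of exp] DERIV_exp DERIV_minus DERIV_inverse) simp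
    have "((\<lambda>t. poly p (inverse t) * exp (- inverse t)) has_real_derivative
        flat_exp ((p - pderiv p) * [:0, 0, 1:]) t) (at t)"
      using DERIV_mult[OF P E] 1 by (simp add: flat_exp_def algebra_simps)
    then show ?thesis
      using 1 by (elim has_field_derivative_transform_within_open[where S = "{0<..}"])
        (auto simp: flat_exp_def)
  next
    case 2
    have "((\<lambda>t. 0) has_real_derivative 0) (at t)" by simp
    then have "(flat_exp p has_real_derivative 0) (at t)"
      using 2 by (elim has_field_derivative_transform_within_open[where S = "{..<0}"])
        (auto simp: flat_exp_def)
    then show ?thesis
      using 2 by (simp add: flat_exp_def)
  next
    case 3
    have "((\<lambda>h. flat_exp p h / h) \<longlongrightarrow> 0) (at_right 0)"
    proof (rule Lim_transform_eventually)
      show "((\<lambda>h. poly (p * [:0,1:]) (inverse h) * exp (- inverse h)) \<longlongrightarrow> 0) (at_right 0)"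
        by (rule filterlim_compose[OF poly_times_exp_minus_tendsto_0 filterlim_inverse_at_top_right])
      show "\<forall>\<^sub>F h in at_right 0. poly (p * [:0,1:]) (inverse h) * exp (- inverse h) = flat_exp p h / h"
        by (auto simp: eventually_at_filter flat_exp_def field_simps)
    qed
    moreover have "((\<lambda>h. flat_exp p h / h) \<longlongrightarrow> 0) (at_left 0)"
      by (rule Lim_transform_eventually[OF tendsto_const])
         (auto simp: eventually_at_filter flat_exp_def)
    ultimately have "((\<lambda>h. flat_exp p h / h) \<longlongrightarrow> 0) (at 0)"
      by (simp add: filterlim_at_split)
    then show ?thesis
      using 3 by (simp add: DERIV_def flat_exp_def)
  qed
qed

lemma Ck_on_flat_exp: "Ck_on k UNIV (flat_exp p)"
proof (induction k arbitrary: p)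
  case 0
  then show ?case
    using DERIV_isCont[OF flat_exp_has_derivative] by (simp add: continuous_at_imp_continuous_on)
next
  case (Suc k)
  show ?case
  proof (rule Ck_on_SucI)
    show "(flat_exp p has_derivative (\<lambda>v. flat_exp ((p - pderiv p) * [:0, 0, 1:]) t * v)) (at t)" for t
      using flat_exp_has_derivative[of p t] by (simp add: has_field_derivative_def)
    show "Ck_on k UNIV (\<lambda>t. flat_exp ((p - pderiv p) * [:0, 0, 1:]) t * v)" for v
      by (rule Ck_on_linear_compose[OF open_UNIV bounded_linear_mult_left Suc.IH])
  qed simp
qed

lemma Ck_on_inverse: "Ck_on k {x. x \<noteq> 0} (inverse :: real \<Rightarrow> real)"
proof (induction k)
  case (Suc k)
  have op: "open {x::real. x \<noteq> 0}"
    by (intro open_Collect_neq continuous_intros)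
  show ?case
  proof (rule Ck_on_SucI[OF op])
    show "((inverse :: real \<Rightarrow> real) has_derivative (\<lambda>v. (- v) *\<^sub>R (inverse x *\<^sub>R inverse x))) (at x)"
      if "x \<in> {x. x \<noteq> 0}" for x
      by (rule has_derivative_eq_rhs[OF has_derivative_inverse']) (use that in auto)
    show "Ck_on k {x. x \<noteq> 0} (\<lambda>x. (- v) *\<^sub>R (inverse x *\<^sub>R inverse x))" for v :: real
      by (rule Ck_on_scaleR[OF op Ck_on_const[OF op] Ck_on_scaleR[OF op Suc.IH Suc.IH]])
  qed
qed (simp add: continuous_on_inverse continuous_on_id)

text \<open>With \<open>f(t) = e\<^bsup>-1/t\<^esup>\<close>, extended by \<open>0\<close>, the quotient \<open>\<sigma>(t) = f(t) / (f(t) + f(1 - t))\<close> is a smooth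
step from \<open>0\<close> on \<open>t \<le> 0\<close> to \<open>1\<close> on \<open>t \<ge> 1\<close>. The bump function is
\<open>\<sigma> (2 - 2 \<bar>x - x\<^sub>0\<bar>\<^sup>2 / R\<^sup>2)\<close>, where the closed ball of radius \<open>R\<close> lies in \<open>W\<close>.\<close>

lemma smooth_bump:
  fixes x0 :: "'a::euclidean_space"
  assumes "open W" "x0 \<in> W"
  obtains \<beta> :: "'a \<Rightarrow> real" and r K where "\<And>k. Ck_on k UNIV \<beta>" "r > 0" 
    "\<And>x. x \<in> ball x0 r \<Longrightarrow> \<beta> x = 1" "\<And>x. x \<notin> K \<Longrightarrow> \<beta> x = 0" "compact K" "K \<subseteq> W"
proof -
  obtain R where R: "R > 0" "cball x0 R \<subseteq> W"
    using assms open_contains_cball by blast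
  let ?f = "flat_exp 1"
  have f0: "?f t = 0" if "t \<le> 0" for t using that by (simp add: flat_exp_def)
  have fpos: "?f t > 0" if "t > 0" for t using that by (simp add: flat_exp_def)
  have fnn: "?f t \<ge> 0" for t by (simp add: flat_exp_def)
  define \<sigma> where "\<sigma> t = ?f t *\<^sub>R inverse (?f t + ?f (1 + - t))" for t
  have den: "?f t + ?f (1 + - t) \<noteq> 0" for t
    using fpos[of t] fpos[of "1 + - t"] fnn[of t] fnn[of "1 + - t"] by (cases "t > 0") auto
  have Ckneg: "Ck_on k UNIV (\<lambda>t::real. - t)" for k
    by (rule Ck_on_linear) (auto intro: bounded_linear_minus bounded_linear_ident)
  have C\<sigma>: "Ck_on k UNIV \<sigma>" for k
  proof -
    have "Ck_on k UNIV (\<lambda>t. ?f (1 + - t))"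
      by (rule Ck_on_compose[OF open_UNIV open_UNIV subset_UNIV
            Ck_on_add[OF open_UNIV Ck_on_const[OF open_UNIV] Ckneg] Ck_on_flat_exp])
    then have "Ck_on k UNIV (\<lambda>t. ?f t + ?f (1 + - t))"
      by (rule Ck_on_add[OF open_UNIV Ck_on_flat_exp])
    moreover have "open {x::real. x \<noteq> 0}"
      by (intro open_Collect_neq continuous_intros)
    moreover have "(\<lambda>t. ?f t + ?f (1 + - t)) ` UNIV \<subseteq> {x. x \<noteq> 0}"
      by (auto simp only: den image_iff mem_Collect_eq)
    ultimately have "Ck_on k UNIV (\<lambda>t. inverse (?f t + ?f (1 + - t)))"
      by (rule Ck_on_compose[OF open_UNIV _ _ _ Ck_on_inverse, rotated 2])
    then show ?thesis
      unfolding \<sigma>_def[abs_def] by (rule Ck_on_scaleR[OF open_UNIV Ck_on_flat_exp])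
  qed
  define \<beta> where "\<beta> x = \<sigma> (2 + (- 2 / R\<^sup>2) *\<^sub>R (\<Sum>b\<in>Basis. ((x + - x0) \<bullet> b) *\<^sub>R ((x + - x0) \<bullet> b)))" for x
  have \<beta>: "\<beta> x = \<sigma> (2 - 2 * (dist x0 x)\<^sup>2 / R\<^sup>2)" for x
  proof -
    have "(\<Sum>b\<in>Basis. ((x + - x0) \<bullet> b) *\<^sub>R ((x + - x0) \<bullet> b)) = (dist x0 x)\<^sup>2"
      using euclidean_inner[of "x + - x0" "x + - x0"]
      by (simp add: dist_norm norm_minus_commute[of x0 x] power2_norm_eq_inner)
    then show ?thesis
      by (simp only: \<beta>_def) simp
  qed
  show ?thesis
  proof
    have lin: "Ck_on k UNIV (\<lambda>x. (x + - x0) \<bullet> b)" for k b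
      by (rule Ck_on_linear_compose[OF open_UNIV bounded_linear_inner_left
            Ck_on_add[OF open_UNIV Ck_on_linear[OF open_UNIV bounded_linear_ident] Ck_on_const[OF open_UNIV]]])
    have sq: "Ck_on k UNIV (\<lambda>x. \<Sum>b\<in>Basis. ((x + - x0) \<bullet> b) *\<^sub>R ((x + - x0) \<bullet> b))" for k
      by (rule Ck_on_sum[OF open_UNIV Ck_on_scaleR[OF open_UNIV lin lin]])
    have "Ck_on k UNIV (\<lambda>x. 2 + (- 2 / R\<^sup>2) *\<^sub>R (\<Sum>b\<in>Basis. ((x + - x0) \<bullet> b) *\<^sub>R ((x + - x0) \<bullet> b)))" for k
      by (rule Ck_on_add[OF open_UNIV Ck_on_const[OF open_UNIV] Ck_on_scaleR[OF open_UNIV Ck_on_const[OF open_UNIV] sq]])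
    then show "Ck_on k UNIV \<beta>" for k
      unfolding \<beta>_def[abs_def] by (rule Ck_on_compose[OF open_UNIV open_UNIV subset_UNIV _ C\<sigma>])
    show "R / 2 > 0" using R by simp
    show "\<beta> x = 1" if "x \<in> ball x0 (R / 2)" for x
    proof -
      have "(dist x0 x)\<^sup>2 \<le> (R / 2)\<^sup>2"
        using that by (intro power_mono) auto
      then have "4 * (dist x0 x)\<^sup>2 \<le> R\<^sup>2"
        by (simp add: power_divide)
      then have "2 * (dist x0 x)\<^sup>2 \<le> R\<^sup>2"
        using zero_le_power2[of "dist x0 x"] by linarith
      then have "2 - 2 * (dist x0 x)\<^sup>2 / R\<^sup>2 \<ge> 1"
        using R by (simp add: divide_le_eq)
      moreover have "\<sigma> t = 1" if "t \<ge> 1" for t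
        using f0[of "1 + - t"] fpos[of t] that by (simp add: \<sigma>_def)
      ultimately show ?thesis by (simp add: \<beta>)
    qed
    show "\<beta> x = 0" if "x \<notin> cball x0 R" for x
    proof -
      have "(dist x0 x)\<^sup>2 \<ge> R\<^sup>2"
        using that R by (intro power_mono) auto
      then have "2 - 2 * (dist x0 x)\<^sup>2 / R\<^sup>2 \<le> 0"
        using R by (simp add: field_simps)
      then show ?thesis by (simp add: \<beta> \<sigma>_def f0)
    qed
    show "compact (cball x0 R)" "cball x0 R \<subseteq> W" using R by auto
  qed
qed

section \<open>Short-time solutions of Lipschitz differential equations\<close>

text \<open>The Picard operator is a contraction on the complete space of bounded continuous functions on the
real line; times outside the interval are projected to it by \<open>cl\<close>, so that this space can be used.
The initial time may be any point of the interval, and the integral from \<open>t1\<close> to \<open>t\<close> is taken as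
a difference of integrals from the left end \<open>c\<close>; this costs the factor \<open>2\<close> in the smallness
condition. The application is to linear equations, which have a global Lipschitz constant.\<close>

lemma short_time_ode_solution:
  fixes f :: "real \<Rightarrow> 'e::euclidean_space \<Rightarrow> 'e"
  assumes t1: "t1 \<in> {c..d}"
    and cont: "\<And>y. continuous_on {c..d} y \<Longrightarrow> continuous_on {c..d} (\<lambda>t. f t (y t))"
    and lip: "\<And>t y z. t \<in> {c..d} \<Longrightarrow> norm (f t y - f t z) \<le> K * norm (y - z)"
    and K: "0 \<le> K" "2 * (K * (d - c)) < 1"
  shows "\<exists>y. y t1 = v \<and> (\<forall>t\<in>{c..d}. (y has_vector_derivative f t (y t)) (at t within {c..d}))"
proof -
  have cd: "c \<le> d" using t1 by simp
  define cl where "cl t = max c (min d t)" for t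
  have cl: "cl t \<in> {c..d}" for t using cd by (auto simp: cl_def)
  have cl_id: "cl t = t" if "t \<in> {c..d}" for t using that by (auto simp: cl_def)
  have ccl: "continuous_on UNIV cl" unfolding cl_def by (intro continuous_intros)
  define I where "I \<phi> t = integral {c..t} (\<lambda>s. f s (apply_bcontfun \<phi> s))" for \<phi> :: "real \<Rightarrow>\<^sub>C 'e" and t
  have cf: "continuous_on {c..d} (\<lambda>s. f s (apply_bcontfun \<phi> s))" for \<phi> :: "real \<Rightarrow>\<^sub>C 'e"
    by (rule cont) simp
  have cI: "continuous_on {c..d} (I \<phi>)" for \<phi>
    unfolding I_def by (rule indefinite_integral_continuous_1[OF integrable_continuous_real[OF cf]])
  \<comment> \<open>the Picard operator; both limits of integration are projected to the interval\<close>
  define \<Phi> where "\<Phi> \<phi> t = v + I \<phi> (cl t) - I \<phi> (cl t1)" for \<phi> t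
  have b\<Phi>: "\<Phi> \<phi> \<in> bcontfun" for \<phi>
  proof -
    let ?h = "\<lambda>s. v + I \<phi> s - I \<phi> (cl t1)"
    have ch: "continuous_on {c..d} ?h" by (intro continuous_intros cI)
    have "continuous_on UNIV (\<lambda>t. ?h (cl t))"
      by (rule continuous_on_compose2[OF ch ccl]) (use cl in blast)
    moreover have "bounded (?h ` {c..d})"
      by (intro compact_imp_bounded compact_continuous_image ch compact_Icc)
    then have "bounded (range (\<lambda>t. ?h (cl t)))"
      by (rule bounded_subset) (use cl in blast)
    ultimately show ?thesis
      by (simp add: bcontfun_def \<Phi>_def[abs_def])
  qed
  define F where "F \<phi> = Bcontfun (\<Phi> \<phi>)" for \<phi>
  have F: "apply_bcontfun (F \<phi>) t = \<Phi> \<phi> t" for \<phi> t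
    using b\<Phi> by (simp add: F_def Bcontfun_inverse)
  have I_lip: "norm (I \<phi> t - I \<psi> t) \<le> K * (d - c) * dist \<phi> \<psi>" if t: "t \<in> {c..d}" for \<phi> \<psi> t
  proof -
    have sub: "{c..t} \<subseteq> {c..d}" using t by auto
    have c1: "continuous_on {c..t} (\<lambda>s. f s (apply_bcontfun \<theta> s))" for \<theta> :: "real \<Rightarrow>\<^sub>C 'e"
      by (rule continuous_on_subset[OF cf sub])
    have "I \<phi> t - I \<psi> t = integral {c..t} (\<lambda>s. f s (apply_bcontfun \<phi> s) - f s (apply_bcontfun \<psi> s))"
      unfolding I_def by (rule integral_diff[symmetric]) (rule integrable_continuous_real[OF c1])+
    also have "norm \<dots> \<le> K * dist \<phi> \<psi> * (t - c)"
    proof (rule integral_bound)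
      show "continuous_on {c..t} (\<lambda>s. f s (apply_bcontfun \<phi> s) - f s (apply_bcontfun \<psi> s))"
        by (rule continuous_on_diff[OF c1 c1])
      fix s assume s: "s \<in> {c..t}"
      have "norm (f s (apply_bcontfun \<phi> s) - f s (apply_bcontfun \<psi> s)) \<le> K * norm (apply_bcontfun \<phi> s - apply_bcontfun \<psi> s)"
        using lip s sub by blast
      also have "\<dots> \<le> K * dist \<phi> \<psi>"
        using dist_bounded[of \<phi> s \<psi>] K(1) by (intro mult_left_mono) (simp_all add: dist_norm)
      finally show "norm (f s (apply_bcontfun \<phi> s) - f s (apply_bcontfun \<psi> s)) \<le> K * dist \<phi> \<psi>" .
    qed (use t in simp)
    also have "\<dots> \<le> K * dist \<phi> \<psi> * (d - c)"
      using t K(1) by (intro mult_left_mono) auto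
    finally show ?thesis by (simp add: mult.assoc mult.commute mult.left_commute)
  qed
  have "\<exists>!\<phi>. F \<phi> = \<phi>"
  proof (rule banach_fix_type)
    show "0 \<le> 2 * (K * (d - c))" using K cd by simp
    show "\<forall>\<phi> \<psi>. dist (F \<phi>) (F \<psi>) \<le> 2 * (K * (d - c)) * dist \<phi> \<psi>"
    proof (intro allI dist_bound)
      fix \<phi> \<psi> t
      have "dist (apply_bcontfun (F \<phi>) t) (apply_bcontfun (F \<psi>) t) =
          norm ((I \<phi> (cl t) - I \<psi> (cl t)) - (I \<phi> (cl t1) - I \<psi> (cl t1)))"
        by (simp add: F \<Phi>_def dist_norm algebra_simps)
      also have "\<dots> \<le> norm (I \<phi> (cl t) - I \<psi> (cl t)) + norm (I \<phi> (cl t1) - I \<psi> (cl t1))"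
        by (rule norm_triangle_ineq4)
      also have "\<dots> \<le> K * (d - c) * dist \<phi> \<psi> + K * (d - c) * dist \<phi> \<psi>"
        by (intro add_mono I_lip cl)
      finally show "dist (apply_bcontfun (F \<phi>) t) (apply_bcontfun (F \<psi>) t) \<le> 2 * (K * (d - c)) * dist \<phi> \<psi>"
        by simp
    qed
  qed (rule K)
  then obtain \<phi> where "F \<phi> = \<phi>" by blast
  then have fp: "apply_bcontfun \<phi> t = v + I \<phi> (cl t) - I \<phi> (cl t1)" for t
    using F[of \<phi> t] by (simp add: \<Phi>_def)
  show ?thesis
  proof (intro exI[of _ "apply_bcontfun \<phi>"] conjI ballI)
    show "apply_bcontfun \<phi> t1 = v" by (simp add: fp)
    fix t assume t: "t \<in> {c..d}"
    have "(I \<phi> has_vector_derivative f t (apply_bcontfun \<phi> t)) (at t within {c..d})"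
      unfolding I_def by (rule integral_has_vector_derivative[OF cf t])
    then have "((\<lambda>s. (v - I \<phi> (cl t1)) + I \<phi> s) has_vector_derivative 0 + f t (apply_bcontfun \<phi> t)) (at t within {c..d})"
      by (intro has_vector_derivative_add has_vector_derivative_const)
    then show "(apply_bcontfun \<phi> has_vector_derivative f t (apply_bcontfun \<phi> t)) (at t within {c..d})"
      by (intro has_vector_derivative_transform_within[OF _ zero_less_one t,
            of "\<lambda>s. (v - I \<phi> (cl t1)) + I \<phi> s" _ "apply_bcontfun \<phi>"])
         (simp_all add: fp cl_id)
  qed
qed

section \<open>Covariant derivatives and parallel fields along a curve\<close>

text \<open>At an end point of the interval the derivative is one-sided. Near each point it is the
derivative of a smooth extension to an open set, hence continuous.\<close>

lemma smooth_on_interval_C1: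
  fixes f :: "real \<Rightarrow> real"
  assumes cd: "c < d" and f: "smooth_on {c..d} f"
  shows "continuous_on {c..d} (\<lambda>t. vector_derivative f (at t within {c..d}))"
  unfolding continuous_on_eq_continuous_within
proof
  let ?f' = "\<lambda>t. vector_derivative f (at t within {c..d})"
  fix t assume t: "t \<in> {c..d}"
  then have "\<exists>V h. open V \<and> t \<in> V \<and> (\<forall>k. Ck_on k V h) \<and> (\<forall>s\<in>{c..d} \<inter> V. h s = f s)"
    using f by (simp only: smooth_on_def)
  then obtain V h where V: "open V" "t \<in> V" "\<forall>k. Ck_on k V h" and h: "\<forall>s\<in>{c..d} \<inter> V. h s = f s"
    by (elim exE conjE)
  have C1: "Ck_on (Suc 0) V h" using V(3) by blast
  let ?h' = "\<lambda>s. frechet_derivative h (at s) 1"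
  have eq: "?f' s = ?h' s" if s: "s \<in> {c..d} \<inter> V" for s
  proof -
    have D: "(h has_derivative frechet_derivative h (at s)) (at s)"
      using C1 s by (simp add: frechet_derivative_works)
    have "frechet_derivative h (at s) = (\<lambda>x. x *\<^sub>R ?h' s)"
    proof
      show "frechet_derivative h (at s) x = x *\<^sub>R ?h' s" for x
        using linear_cmul[OF has_derivative_linear[OF D], of x 1] by simp
    qed
    with D have "(h has_vector_derivative ?h' s) (at s)"
      by (simp only: has_vector_derivative_def)
    then have "(h has_vector_derivative ?h' s) (at s within {c..d})"
      by (rule has_vector_derivative_at_within)
    moreover obtain e where e: "e > 0" "ball s e \<subseteq> V"
      using V(1) s open_contains_ball by blast
    ultimately have "(f has_vector_derivative ?h' s) (at s within {c..d})"
      using s h by (elim has_vector_derivative_transform_within[OF _ e(1)])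
        (use e(2) in \<open>auto simp: dist_commute subset_iff\<close>)
    then show ?thesis
      using s cd by (intro vector_derivative_within_closed_interval) auto
  qed
  have "continuous_on V ?h'" using C1 by simp
  then have "isCont ?h' t"
    using V(1,2) continuous_on_eq_continuous_at by blast
  then have "continuous (at t within {c..d}) ?h'"
    by (rule continuous_at_imp_continuous_at_within)
  moreover obtain e where e: "e > 0" "ball t e \<subseteq> V"
    using V(1,2) open_contains_ball by blast
  ultimately show "continuous (at t within {c..d}) ?f'"
    by (elim continuous_transform_within[OF _ e(1) t])
       (use eq e(2) in \<open>auto simp: dist_commute subset_iff\<close>)
qed

lemma at_within_Icc_neq_bot: "c < d \<Longrightarrow> t \<in> {c..d} \<Longrightarrow> at t within {c..d::real} \<noteq> bot"
  by (simp add: trivial_limit_within islimpt_Icc)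

text \<open>Used to cut a smooth piece of a curve down to the domain of a frame or to the overlap of two pieces.\<close>

lemma smooth_curve_on_subset:
  assumes "smooth_curve_on A S \<gamma>" "T \<subseteq> S"
  shows "smooth_curve_on A T \<gamma>"
  unfolding smooth_curve_on_def
proof (intro conjI ballI)
  show "continuous_on T \<gamma>"
    using assms by (auto simp: smooth_curve_on_def intro: continuous_on_subset)
  fix c assume "c \<in> A"
  then have "case c of (U, \<phi>) \<Rightarrow> smooth_on {t\<in>S. \<gamma> t \<in> U} (\<phi> \<circ> \<gamma>)"
    using assms(1) by (simp only: smooth_curve_on_def)
  moreover have "{t\<in>T. \<gamma> t \<in> fst c} \<subseteq> {t\<in>S. \<gamma> t \<in> fst c}" using assms(2) by blast
  ultimately show "case c of (U, \<phi>) \<Rightarrow> smooth_on {t\<in>T. \<gamma> t \<in> U} (\<phi> \<circ> \<gamma>)"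
    using smooth_on_subset by (simp add: split_beta)
qed

lemma sum_fun_apply: "(\<Sum>i\<in>I. f i) x = (\<Sum>i\<in>I. f i x)" for f :: "'i \<Rightarrow> 'x \<Rightarrow> 'y::comm_monoid_add"
  by (induction I rule: infinite_finite_induct) auto

lemma tscale_sum: "r *\<^sub>T (\<Sum>i\<in>I. f i) = (\<Sum>i\<in>I. r *\<^sub>T f i)"
  by (auto simp: fun_eq_iff tscale_def sum_fun_apply sum_distrib_left)

text \<open>Frames are indexed by a basis, so their sums are renumbered by an initial segment of the natural
numbers.\<close>

lemma has_covariant_derivative_finite:
  assumes I: "finite I"
    and Y: "\<And>i. i \<in> I \<Longrightarrow> Y i \<in> vector_fields A"
    and f: "\<And>i. i \<in> I \<Longrightarrow> (f i has_real_derivative f' i) (at t within S)"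
    and V: "\<And>s. s \<in> S \<Longrightarrow> V s = (\<Sum>i\<in>I. f i s *\<^sub>T Y i (\<gamma> s))"
    and X: "X \<in> vector_fields A" "X (\<gamma> t) = velocity A S \<gamma> t"
    and w: "w = (\<Sum>i\<in>I. f' i *\<^sub>T Y i (\<gamma> t) + f i t *\<^sub>T D X (Y i) (\<gamma> t))"
  shows "has_covariant_derivative A D S \<gamma> V w t"
proof -
  obtain e where e: "bij_betw e {..<card I} I"
    using ex_bij_betw_nat_finite[OF I] by (auto simp: atLeast0LessThan)
  have eI: "e i \<in> I" if "i < card I" for i
    using e that by (auto simp: bij_betw_def)
  show ?thesis
    unfolding has_covariant_derivative_def
  proof (intro exI[of _ "card I"] exI[of _ "Y \<circ> e"] exI[of _ "f \<circ> e"] exI[of _ "f' \<circ> e"] exI[of _ X] conjI)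
    show "\<forall>i<card I. (Y \<circ> e) i \<in> vector_fields A \<and> ((f \<circ> e) i has_real_derivative (f' \<circ> e) i) (at t within S)"
      using eI Y f by simp
    show "\<exists>\<epsilon>>0. \<forall>s\<in>S. \<bar>s - t\<bar> < \<epsilon> \<longrightarrow> V s = (\<Sum>i<card I. (f \<circ> e) i s *\<^sub>T (Y \<circ> e) i (\<gamma> s))"
    proof -
      have "V s = (\<Sum>i<card I. (f \<circ> e) i s *\<^sub>T (Y \<circ> e) i (\<gamma> s))" if "s \<in> S" for s
        unfolding o_apply sum.reindex_bij_betw[OF e, of "\<lambda>i. f i s *\<^sub>T Y i (\<gamma> s)"]
        by (rule V[OF that])
      then show ?thesis using zero_less_one by blast
    qed
    show "w = (\<Sum>i<card I. (f' \<circ> e) i *\<^sub>T (Y \<circ> e) i (\<gamma> t) + (f \<circ> e) i t *\<^sub>T D X ((Y \<circ> e) i) (\<gamma> t))"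
      using w sum.reindex_bij_betw[OF e, of "\<lambda>i. f' i *\<^sub>T Y i (\<gamma> t) + f i t *\<^sub>T D X (Y i) (\<gamma> t)"]
      by (simp only: o_apply)
  qed (rule X)+
qed

lemma has_covariant_derivativeE:
  assumes "has_covariant_derivative A D S \<gamma> V w t"
  obtains n :: nat and Y f f' X \<epsilon> where "\<And>i. i < n \<Longrightarrow> Y i \<in> vector_fields A"
    "\<And>i. i < n \<Longrightarrow> (f i has_real_derivative f' i) (at t within S)"
    "\<epsilon> > 0" "\<And>s. s \<in> S \<Longrightarrow> \<bar>s - t\<bar> < \<epsilon> \<Longrightarrow> V s = (\<Sum>i<n. f i s *\<^sub>T Y i (\<gamma> s))"
    "X \<in> vector_fields A" "X (\<gamma> t) = velocity A S \<gamma> t"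
    "w = (\<Sum>i<n. f' i *\<^sub>T Y i (\<gamma> t) + f i t *\<^sub>T D X (Y i) (\<gamma> t))"
proof -
  from assms have "\<exists>(n::nat) Y f f' X.
        (\<forall>i<n. Y i \<in> vector_fields A \<and> (f i has_real_derivative f' i) (at t within S)) \<and>
        (\<exists>\<epsilon>>0. \<forall>s\<in>S. \<bar>s - t\<bar> < \<epsilon> \<longrightarrow> V s = (\<Sum>i<n. f i s *\<^sub>T Y i (\<gamma> s))) \<and>
        X \<in> vector_fields A \<and> X (\<gamma> t) = velocity A S \<gamma> t \<and>
        w = (\<Sum>i<n. f' i *\<^sub>T Y i (\<gamma> t) + f i t *\<^sub>T D X (Y i) (\<gamma> t))"
    by (simp only: has_covariant_derivative_def)
  then show thesis
  proof (elim exE conjE)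
    fix n :: nat and Y f f' X \<epsilon>
    assume *: "\<forall>i<n. Y i \<in> vector_fields A \<and> (f i has_real_derivative f' i) (at t within S)"
      "0 < \<epsilon>" "\<forall>s\<in>S. \<bar>s - t\<bar> < \<epsilon> \<longrightarrow> V s = (\<Sum>i<n. f i s *\<^sub>T Y i (\<gamma> s))"
      "X \<in> vector_fields A" "X (\<gamma> t) = velocity A S \<gamma> t"
      "w = (\<Sum>i<n. f' i *\<^sub>T Y i (\<gamma> t) + f i t *\<^sub>T D X (Y i) (\<gamma> t))"
    show thesis
      by (rule that[of n Y f f' \<epsilon> X]) (use * in blast)+
  qed
qed

lemma has_covariant_derivative_cong:
  assumes "has_covariant_derivative A D S \<gamma> V w t" and "\<And>s. s \<in> S \<Longrightarrow> V s = V' s"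
  shows "has_covariant_derivative A D S \<gamma> V' w t"
proof -
  have "(\<forall>s\<in>S. \<bar>s - t\<bar> < \<epsilon> \<longrightarrow> V s = F s) = (\<forall>s\<in>S. \<bar>s - t\<bar> < \<epsilon> \<longrightarrow> V' s = F s)" for \<epsilon> F
    using assms(2) by auto
  with assms(1) show ?thesis
    by (simp only: has_covariant_derivative_def)
qed

lemma partition_piece_right:
  fixes \<tau> :: "nat \<Rightarrow> real"
  assumes "\<tau> 0 \<le> x" "x < \<tau> n"
  shows "\<exists>i<n. \<tau> i \<le> x \<and> x < \<tau> (Suc i)"
  using assms(2)
proof (induction n)
  case (Suc n)
  then show ?case
    by (cases "x < \<tau> n") (auto intro: less_SucI simp: not_less)
qed (use assms(1) in simp)

lemma partition_piece_left:
  fixes \<tau> :: "nat \<Rightarrow> real"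
  assumes "\<tau> 0 < x" "x \<le> \<tau> n"
  shows "\<exists>i<n. \<tau> i < x \<and> x \<le> \<tau> (Suc i)"
  using assms(2)
proof (induction n)
  case (Suc n)
  then show ?case
    by (cases "x \<le> \<tau> n") (auto intro: less_SucI simp: not_le)
qed (use assms(1) in simp)

lemma partition_mono:
  assumes "smooth_partition A a b \<gamma> n \<tau>" "i \<le> j" "j \<le> n"
  shows "\<tau> i \<le> \<tau> j"
  using assms(2,3)
proof (induction j rule: dec_induct)
  case (step j)
  then have "\<tau> j < \<tau> (Suc j)"
    using assms(1) by (simp add: smooth_partition_def)
  with step show ?case by simp
qed simp

lemma parallel_alongE:
  assumes "parallel_along A D a b \<gamma> V"
  obtains n \<tau> where "smooth_partition A a b \<gamma> n \<tau>"
    "\<And>i t. i < n \<Longrightarrow> t \<in> {\<tau> i..\<tau> (Suc i)} \<Longrightarrow> has_covariant_derivative A D {\<tau> i..\<tau> (Suc i)} \<gamma> V 0 t"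
  using assms unfolding parallel_along_def by (elim exE conjE) (rule that, blast+)

lemma parallel_along_right:
  assumes V: "parallel_along A D a b \<gamma> V" and x: "a \<le> x" "x < b"
  shows "\<exists>l r. l \<le> x \<and> x < r \<and> smooth_curve_on A {l..r} \<gamma> \<and>
    (\<forall>t\<in>{l..r}. has_covariant_derivative A D {l..r} \<gamma> V 0 t)"
proof (rule parallel_alongE[OF V])
  fix n \<tau>
  assume p: "smooth_partition A a b \<gamma> n \<tau>"
    and h: "\<And>i t. i < n \<Longrightarrow> t \<in> {\<tau> i..\<tau> (Suc i)} \<Longrightarrow> has_covariant_derivative A D {\<tau> i..\<tau> (Suc i)} \<gamma> V 0 t"
  have "\<tau> 0 \<le> x" "x < \<tau> n" using p x by (simp_all add: smooth_partition_def)
  then obtain i where i: "i < n" "\<tau> i \<le> x" "x < \<tau> (Suc i)"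
    using partition_piece_right by blast
  then have "smooth_curve_on A {\<tau> i..\<tau> (Suc i)} \<gamma>"
    using p by (simp add: smooth_partition_def)
  with i h[OF i(1)] show ?thesis by blast
qed

lemma parallel_along_left:
  assumes V: "parallel_along A D a b \<gamma> V" and x: "a < x" "x \<le> b"
  shows "\<exists>l r. l < x \<and> x \<le> r \<and> smooth_curve_on A {l..r} \<gamma> \<and>
    (\<forall>t\<in>{l..r}. has_covariant_derivative A D {l..r} \<gamma> V 0 t)"
proof (rule parallel_alongE[OF V])
  fix n \<tau>
  assume p: "smooth_partition A a b \<gamma> n \<tau>"
    and h: "\<And>i t. i < n \<Longrightarrow> t \<in> {\<tau> i..\<tau> (Suc i)} \<Longrightarrow> has_covariant_derivative A D {\<tau> i..\<tau> (Suc i)} \<gamma> V 0 t"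
  have "\<tau> 0 < x" "x \<le> \<tau> n" using p x by (simp_all add: smooth_partition_def)
  then obtain i where i: "i < n" "\<tau> i < x" "x \<le> \<tau> (Suc i)"
    using partition_piece_left by blast
  then have "smooth_curve_on A {\<tau> i..\<tau> (Suc i)} \<gamma>"
    using p by (simp add: smooth_partition_def)
  with i h[OF i(1)] show ?thesis by blast
qed

lemma parallel_along_piece:
  assumes "c < d" "smooth_curve_on A {c..d} \<gamma>"
    and "\<And>t. t \<in> {c..d} \<Longrightarrow> has_covariant_derivative A D {c..d} \<gamma> V 0 t"
  shows "parallel_along A D c d \<gamma> V"
  unfolding parallel_along_def smooth_partition_def
  by (intro exI[of _ "Suc 0"] exI[of _ "\<lambda>i. if i = 0 then c else d"]) (use assms in auto)

text \<open>The two partitions are concatenated. At the junction, a break point of the new partition, each field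
keeps its one-sided covariant derivative, so only the values have to match there.\<close>

lemma parallel_along_join:
  assumes V: "parallel_along A D c m \<gamma> V" and W: "parallel_along A D m d \<gamma> W" and VW: "V m = W m"
  shows "parallel_along A D c d \<gamma> (\<lambda>t. if t \<le> m then V t else W t)" (is "parallel_along A D c d \<gamma> ?Z")
proof (rule parallel_alongE[OF V], rule parallel_alongE[OF W])
  fix n \<tau> n' \<tau>'
  assume p: "smooth_partition A c m \<gamma> n \<tau>"
    and h: "\<And>i t. i < n \<Longrightarrow> t \<in> {\<tau> i..\<tau> (Suc i)} \<Longrightarrow> has_covariant_derivative A D {\<tau> i..\<tau> (Suc i)} \<gamma> V 0 t"
    and p': "smooth_partition A m d \<gamma> n' \<tau>'"
    and h': "\<And>i t. i < n' \<Longrightarrow> t \<in> {\<tau>' i..\<tau>' (Suc i)} \<Longrightarrow> has_covariant_derivative A D {\<tau>' i..\<tau>' (Suc i)} \<gamma> W 0 t"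
  define \<sigma> where "\<sigma> i = (if i \<le> n then \<tau> i else \<tau>' (i - n))" for i
  have ends: "\<tau> n = m" "\<tau>' 0 = m" "\<tau> 0 = c" "\<tau>' n' = d"
    using p p' by (simp_all add: smooth_partition_def)
  have \<sigma>': "\<sigma> i = \<tau>' (i - n)" if "n \<le> i" for i
    using that ends by (auto simp: \<sigma>_def)
  have piece: "\<sigma> i < \<sigma> (Suc i) \<and> smooth_curve_on A {\<sigma> i..\<sigma> (Suc i)} \<gamma> \<and>
      (\<forall>t\<in>{\<sigma> i..\<sigma> (Suc i)}. has_covariant_derivative A D {\<sigma> i..\<sigma> (Suc i)} \<gamma> ?Z 0 t)" if i: "i < n + n'" for i
  proof (cases "i < n")
    case True
    then have eq: "\<sigma> i = \<tau> i" "\<sigma> (Suc i) = \<tau> (Suc i)" by (simp_all add: \<sigma>_def)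
    have "\<tau> (Suc i) \<le> m"
      using partition_mono[OF p, of "Suc i" n] True ends by simp
    then have "V s = ?Z s" if "s \<in> {\<tau> i..\<tau> (Suc i)}" for s using that by simp
    then have "has_covariant_derivative A D {\<tau> i..\<tau> (Suc i)} \<gamma> ?Z 0 t" if "t \<in> {\<tau> i..\<tau> (Suc i)}" for t
      by (rule has_covariant_derivative_cong[OF h[OF True that]])
    then show ?thesis
      using p True unfolding eq by (simp add: smooth_partition_def)
  next
    case False
    define j where "j = i - n"
    have j: "j < n'" "i = n + j" using False i by (auto simp: j_def)
    then have eq: "\<sigma> i = \<tau>' j" "\<sigma> (Suc i) = \<tau>' (Suc j)" by (simp_all add: \<sigma>')
    have "m \<le> \<tau>' j"
      using partition_mono[OF p', of 0 j] j ends by simp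
    then have "W s = ?Z s" if "s \<in> {\<tau>' j..\<tau>' (Suc j)}" for s
      using that VW by (cases "s = m") auto
    then have "has_covariant_derivative A D {\<tau>' j..\<tau>' (Suc j)} \<gamma> ?Z 0 t" if "t \<in> {\<tau>' j..\<tau>' (Suc j)}" for t
      by (rule has_covariant_derivative_cong[OF h'[OF j(1) that]])
    then show ?thesis
      using p' j(1) unfolding eq by (simp add: smooth_partition_def)
  qed
  have "\<sigma> 0 = c" "\<sigma> (n + n') = d" using ends \<sigma>'[of "n + n'"] by (simp_all add: \<sigma>_def)
  with piece show ?thesis
    unfolding parallel_along_def smooth_partition_def
    by (intro exI[of _ "n + n'"] exI[of _ \<sigma>]) blast
qed

text \<open>The initial time ranges over the whole interval because transport runs in both directions.\<close>

definition transportable ::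
  "('m::{t2_space, second_countable_topology}, 'e::euclidean_space) chart set \<Rightarrow> 'm connection \<Rightarrow>
   (real \<Rightarrow> 'm) \<Rightarrow> real \<Rightarrow> real \<Rightarrow> bool" where
  "transportable A D \<gamma> c d \<longleftrightarrow>
     (\<forall>t\<in>{c..d}. \<forall>v\<in>tangent_space A (\<gamma> t). \<exists>V. parallel_along A D c d \<gamma> V \<and> V t = v)"

section \<open>Charts and smooth functions on a manifold\<close>

text \<open>The coordinate vector \<open>\<Sum>\<^sub>b \<xi>\<^sub>b \<partial>/\<partial>x\<^sub>b\<close> at \<open>p\<close> of a chart. The value \<open>0\<close> on functions that are
not smooth is the convention for velocities, so that velocities are chart vectors as functions.\<close>

definition chart_vector ::
  "('m::{t2_space, second_countable_topology}, 'e::euclidean_space) chart set \<Rightarrow> 'm set \<Rightarrow> ('m \<Rightarrow> 'e) \<Rightarrow> 'm \<Rightarrow> 'e \<Rightarrow> 'm tvec" where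
  "chart_vector A U \<phi> p \<xi> =
     (\<lambda>u. if u \<in> smooth_functions A then frechet_derivative (u \<circ> inv_into U \<phi>) (at (\<phi> p)) \<xi> else 0)"

context
  fixes A :: "('m::{t2_space, second_countable_topology}, 'e::euclidean_space) chart set"
  assumes mfd: "smooth_manifold A"
begin

lemma chart_at:
  obtains U \<phi> where "(U, \<phi>) \<in> A" "p \<in> U"
proof -
  have "p \<in> (\<Union>(U, \<phi>)\<in>A. U)"
    using mfd by (simp add: smooth_manifold_def)
  then show ?thesis
    by (auto intro: that)
qed

lemma chart_open: "(U, \<phi>) \<in> A \<Longrightarrow> open U"
  and chart_image_open: "(U, \<phi>) \<in> A \<Longrightarrow> open (\<phi> ` U)"
  and chart_homeo: "(U, \<phi>) \<in> A \<Longrightarrow> homeomorphism U (\<phi> ` U) \<phi> (inv_into U \<phi>)"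
  using mfd by (auto simp: smooth_manifold_def dest: bspec)

lemma chart_inv:
  assumes "(U, \<phi>) \<in> A" "q \<in> U"
  shows "inv_into U \<phi> (\<phi> q) = q"
  using homeomorphism_apply1[OF chart_homeo] assms by blast

lemma chart_cont: "(U, \<phi>) \<in> A \<Longrightarrow> continuous_on U \<phi>"
  and chart_inv_cont: "(U, \<phi>) \<in> A \<Longrightarrow> continuous_on (\<phi> ` U) (inv_into U \<phi>)"
  using chart_homeo by (auto simp: homeomorphism_def)

lemma chart_open_image:
  assumes "(U, \<phi>) \<in> A" "open V" "V \<subseteq> U"
  shows "open (\<phi> ` V)"
proof -
  have "openin (top_of_set U) V"
    using assms by (simp add: open_subset)
  then have "openin (top_of_set (\<phi> ` U)) (\<phi> ` V)"
    by (rule homeomorphism_imp_open_map[OF chart_homeo[OF assms(1)]])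
  then show ?thesis
    using chart_image_open[OF assms(1)] openin_open_trans by blast
qed

lemma transition_Ck:
  assumes "(U, \<phi>) \<in> A" "(W, \<psi>) \<in> A"
  shows "Ck_on k (\<phi> ` (U \<inter> W)) (\<psi> \<circ> inv_into U \<phi>)"
proof -
  have "smooth_on (\<phi> ` (U \<inter> W)) (\<psi> \<circ> inv_into U \<phi>)"
    using mfd assms by (auto simp: smooth_manifold_def dest: bspec)
  moreover have "open (\<phi> ` (U \<inter> W))"
    using chart_open[OF assms(1)] chart_open[OF assms(2)]
    by (auto intro: chart_open_image[OF assms(1)])
  ultimately show ?thesis
    by (simp add: smooth_on_open)
qed

lemma smooth_function_Ck:
  assumes "u \<in> smooth_functions A" "(U, \<phi>) \<in> A"
  shows "Ck_on k (\<phi> ` U) (u \<circ> inv_into U \<phi>)"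
proof -
  have "smooth_on (\<phi> ` U) (u \<circ> inv_into U \<phi>)"
    using assms by (auto simp: smooth_functions_def dest: bspec)
  then show ?thesis
    by (simp add: smooth_on_open[OF chart_image_open[OF assms(2)]])
qed

text \<open>Smoothness may be tested near each point in a single chart of one's choice, since transition maps
are smooth.\<close>

lemma smooth_function_local:
  assumes loc: "\<And>q. \<exists>U \<phi> V. (U, \<phi>) \<in> A \<and> open V \<and> q \<in> V \<and> V \<subseteq> U \<and> (\<forall>k. Ck_on k (\<phi> ` V) (u \<circ> inv_into U \<phi>))"
  shows "u \<in> smooth_functions A"
proof -
  have "smooth_on (\<psi> ` W) (u \<circ> inv_into W \<psi>)" if W: "(W, \<psi>) \<in> A" for W \<psi>
    unfolding smooth_on_open[OF chart_image_open[OF W]]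
  proof (intro allI Ck_on_local)
    fix k y assume "y \<in> \<psi> ` W"
    then obtain q where q: "q \<in> W" "y = \<psi> q" by blast
    obtain U \<phi> V where U: "(U, \<phi>) \<in> A" and V: "open V" "q \<in> V" "V \<subseteq> U"
      and C: "\<And>k. Ck_on k (\<phi> ` V) (u \<circ> inv_into U \<phi>)"
      using loc[of q] by blast
    have opV: "open (\<phi> ` V)" and op: "open (\<psi> ` (W \<inter> V))"
      using U V W chart_open[OF W] by (auto intro: chart_open_image[OF U] chart_open_image[OF W])
    have "Ck_on k (\<psi> ` (W \<inter> V)) (\<phi> \<circ> inv_into W \<psi>)"
      by (rule Ck_on_subset[OF transition_Ck[OF W U]]) (use V in auto)
    moreover have "(\<phi> \<circ> inv_into W \<psi>) ` (\<psi> ` (W \<inter> V)) \<subseteq> \<phi> ` V"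
      using chart_inv[OF W] by auto
    ultimately have "Ck_on k (\<psi> ` (W \<inter> V)) (\<lambda>x. (u \<circ> inv_into U \<phi>) ((\<phi> \<circ> inv_into W \<psi>) x))"
      using C Ck_on_compose[OF op opV] by blast
    then have "Ck_on k (\<psi> ` (W \<inter> V)) (u \<circ> inv_into W \<psi>)"
      by (rule Ck_on_cong[OF op, rotated]) (use chart_inv[OF W] chart_inv[OF U] V in auto)
    with op q V show "\<exists>V. open V \<and> y \<in> V \<and> Ck_on k V (u \<circ> inv_into W \<psi>)" by blast
  qed
  then show ?thesis by (auto simp: smooth_functions_def)
qed

lemma smooth_function_globalI:
  assumes "\<And>U \<phi> k. (U, \<phi>) \<in> A \<Longrightarrow> Ck_on k (\<phi> ` U) (u \<circ> inv_into U \<phi>)"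
  shows "u \<in> smooth_functions A"
proof -
  have "smooth_on (\<phi> ` U) (u \<circ> inv_into U \<phi>)" if "(U, \<phi>) \<in> A" for U \<phi>
    using assms[OF that] by (simp add: smooth_on_open[OF chart_image_open[OF that]])
  then show ?thesis by (auto simp: smooth_functions_def)
qed

lemma smooth_function_mult:
  assumes "u \<in> smooth_functions A" "w \<in> smooth_functions A"
  shows "(\<lambda>q. u q * w q) \<in> smooth_functions A"
proof (rule smooth_function_globalI)
  fix U \<phi> k assume U: "(U, \<phi>) \<in> A"
  show "Ck_on k (\<phi> ` U) ((\<lambda>q. u q * w q) \<circ> inv_into U \<phi>)"
    using Ck_on_scaleR[OF chart_image_open[OF U] smooth_function_Ck[OF assms(1) U] smooth_function_Ck[OF assms(2) U]]
    by (simp add: o_def)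
qed

lemma smooth_function_add:
  assumes "u \<in> smooth_functions A" "w \<in> smooth_functions A"
  shows "(\<lambda>q. u q + w q) \<in> smooth_functions A"
proof (rule smooth_function_globalI)
  fix U \<phi> k assume U: "(U, \<phi>) \<in> A"
  show "Ck_on k (\<phi> ` U) ((\<lambda>q. u q + w q) \<circ> inv_into U \<phi>)"
    using Ck_on_add[OF chart_image_open[OF U] smooth_function_Ck[OF assms(1) U] smooth_function_Ck[OF assms(2) U]]
    by (simp add: o_def)
qed

lemma smooth_function_const: "(\<lambda>q. c) \<in> smooth_functions A"
  by (rule smooth_function_globalI) (simp add: o_def Ck_on_const chart_image_open)

lemma smooth_function_cont:
  assumes u: "u \<in> smooth_functions A"
  shows "continuous_on UNIV u"
proof -
  have "isCont u q" for q
  proof -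
    obtain U \<phi> where U: "(U, \<phi>) \<in> A" "q \<in> U" by (rule chart_at)
    have "continuous_on (\<phi> ` U) (u \<circ> inv_into U \<phi>)"
      using smooth_function_Ck[OF u U(1), of 0] by simp
    then have "continuous_on U (\<lambda>x. (u \<circ> inv_into U \<phi>) (\<phi> x))"
      by (rule continuous_on_compose2[OF _ chart_cont[OF U(1)]]) auto
    then have "continuous_on U u"
      by (rule continuous_on_eq) (simp add: chart_inv[OF U(1)])
    then show ?thesis
      using U chart_open continuous_on_eq_continuous_at by blast
  qed
  then show ?thesis by (simp add: continuous_at_imp_continuous_on)
qed

text \<open>Any smooth function \<open>h\<close> of the coordinates becomes a smooth function on the whole manifold after
multiplication by \<open>\<kappa>\<close> and extension by \<open>0\<close>. Indeed \<open>\<kappa>\<close> vanishes off a compact subset of the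
chart, which is closed because the manifold is Hausdorff, so the product vanishes near every point
outside the chart.\<close>

lemma bump_in_chart:
  assumes U: "(U, \<phi>) \<in> A" and "open N" "p \<in> N" "N \<subseteq> U"
  obtains \<kappa> N' where "open N'" "p \<in> N'" "N' \<subseteq> N" "\<And>q. q \<in> N' \<Longrightarrow> \<kappa> q = (1::real)"
    "\<And>q. q \<notin> N \<Longrightarrow> \<kappa> q = 0"
    "\<And>h. (\<And>k. Ck_on k (\<phi> ` U) h) \<Longrightarrow> (\<lambda>q. if q \<in> U then \<kappa> q * h (\<phi> q) else 0) \<in> smooth_functions A"
proof -
  have opN: "open (\<phi> ` N)" "\<phi> p \<in> \<phi> ` N"
    using assms by (auto intro: chart_open_image[OF U])
  obtain \<beta> :: "'e \<Rightarrow> real" and r K where \<beta>: "\<And>k. Ck_on k UNIV \<beta>" "r > 0"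
    "\<And>x. x \<in> ball (\<phi> p) r \<Longrightarrow> \<beta> x = 1" "\<And>x. x \<notin> K \<Longrightarrow> \<beta> x = 0" "compact K" "K \<subseteq> \<phi> ` N"
    using smooth_bump[OF opN] by blast
  define \<kappa> where "\<kappa> q = (if q \<in> U then \<beta> (\<phi> q) else 0)" for q
  define L where "L = inv_into U \<phi> ` K"
  have KU: "K \<subseteq> \<phi> ` U" using \<beta>(6) \<open>N \<subseteq> U\<close> by blast
  have "compact L"
    unfolding L_def using \<beta>(5) chart_inv_cont[OF U] KU
    by (intro compact_continuous_image) (auto intro: continuous_on_subset)
  then have "closed L" by (rule compact_imp_closed)
  have inL: "q \<in> L" if "q \<in> U" "\<beta> (\<phi> q) \<noteq> 0" for q
  proof -
    have "\<phi> q \<in> K" using that \<beta>(4) by blast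
    then have "inv_into U \<phi> (\<phi> q) \<in> L" by (simp add: L_def)
    then show ?thesis using chart_inv[OF U that(1)] by simp
  qed
  have LN: "q \<in> N" if "q \<in> L" for q
  proof -
    from that obtain x where x: "x \<in> K" "q = inv_into U \<phi> x" by (auto simp: L_def)
    with \<beta>(6) obtain q' where "q' \<in> N" "x = \<phi> q'" by blast
    with x show ?thesis using chart_inv[OF U] \<open>N \<subseteq> U\<close> by auto
  qed
  \<comment> \<open>a part of the chart on which the bump function equals \<open>1\<close>\<close>
  define N' where "N' = N \<inter> \<phi> -` ball (\<phi> p) r"
  show ?thesis
  proof (rule that[of N' \<kappa>])
    show "open N'"
      unfolding N'_def using assms chart_cont[OF U]
      by (intro continuous_open_preimage) (auto intro: continuous_on_subset)
    show "p \<in> N'" using assms \<beta>(2) by (simp add: N'_def)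
    show "N' \<subseteq> N" by (auto simp: N'_def)
    show "\<kappa> q = 1" if "q \<in> N'" for q
      using that \<beta>(3) assms(4) by (auto simp: \<kappa>_def N'_def)
    show "\<kappa> q = 0" if "q \<notin> N" for q
      using that inL LN by (auto simp: \<kappa>_def)
    fix h :: "'e \<Rightarrow> real" assume h: "\<And>k. Ck_on k (\<phi> ` U) h"
    let ?u = "\<lambda>q. if q \<in> U then \<kappa> q * h (\<phi> q) else 0"
    show "?u \<in> smooth_functions A"
    proof (rule smooth_function_local)
      fix q
      show "\<exists>U \<phi> V. (U, \<phi>) \<in> A \<and> open V \<and> q \<in> V \<and> V \<subseteq> U \<and> (\<forall>k. Ck_on k (\<phi> ` V) (?u \<circ> inv_into U \<phi>))"
      proof (cases "q \<in> U")
        case True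
        have "Ck_on k (\<phi> ` U) (?u \<circ> inv_into U \<phi>)" for k
        proof -
          have "Ck_on k (\<phi> ` U) (\<lambda>x. \<beta> x *\<^sub>R h x)"
            by (rule Ck_on_scaleR[OF chart_image_open[OF U] Ck_on_subset[OF \<beta>(1) subset_UNIV] h])
          then show ?thesis
            by (rule Ck_on_cong[OF chart_image_open[OF U], rotated])
               (auto simp: \<kappa>_def chart_inv[OF U])
        qed
        with True U show ?thesis
          using chart_open by blast
      next
        case False
        \<comment> \<open>outside the chart, the function vanishes on the complement of the closed set \<open>L\<close>\<close>
        obtain W \<psi> where W: "(W, \<psi>) \<in> A" "q \<in> W" by (rule chart_at)
        have op: "open (W - L)"
          using W chart_open \<open>closed L\<close> by blast
        have zero: "?u q' = 0" if "q' \<notin> L" for q'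
          using that inL by (auto simp: \<kappa>_def)
        have "Ck_on k (\<psi> ` (W - L)) (?u \<circ> inv_into W \<psi>)" for k
        proof -
          have op': "open (\<psi> ` (W - L))"
            using chart_open_image[OF W(1) op] by blast
          have eq: "0 = (?u \<circ> inv_into W \<psi>) x" if x: "x \<in> \<psi> ` (W - L)" for x
          proof -
            from x obtain q' where "q' \<in> W" "q' \<notin> L" "x = \<psi> q'" by blast
            then show ?thesis
              using zero[OF \<open>q' \<notin> L\<close>] chart_inv[OF W(1) \<open>q' \<in> W\<close>]
              by (simp only: o_apply)
          qed
          show ?thesis
            by (rule Ck_on_cong[OF op' eq Ck_on_const[OF op']])
        qed
        moreover have "q \<in> W - L"
          using False W LN assms(4) by blast
        ultimately show ?thesis
          using W op by blast
      qed
    qed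
  qed
qed

lemma bump_function:
  assumes "open N" "p \<in> N"
  shows "\<exists>\<kappa>\<in>smooth_functions A. \<kappa> p = 1 \<and> (\<forall>q. q \<notin> N \<longrightarrow> \<kappa> q = 0)"
proof -
  obtain U \<phi> where U: "(U, \<phi>) \<in> A" "p \<in> U" by (rule chart_at)
  have N: "open (N \<inter> U)" "p \<in> N \<inter> U" "N \<inter> U \<subseteq> U"
    using assms U chart_open by auto
  show ?thesis
  proof (rule bump_in_chart[OF U(1) N])
    fix \<kappa> N'
    assume c: "p \<in> N'" "\<And>q. q \<in> N' \<Longrightarrow> \<kappa> q = (1::real)" "\<And>q. q \<notin> N \<inter> U \<Longrightarrow> \<kappa> q = 0"
      and ext: "\<And>h. (\<And>k. Ck_on k (\<phi> ` U) h) \<Longrightarrow> (\<lambda>q. if q \<in> U then \<kappa> q * h (\<phi> q) else 0) \<in> smooth_functions A"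
    have "(\<lambda>q. if q \<in> U then \<kappa> q * 1 else 0) \<in> smooth_functions A"
      by (rule ext) (rule Ck_on_const[OF chart_image_open[OF U(1)]])
    moreover have "(\<lambda>q. if q \<in> U then \<kappa> q * 1 else 0) = \<kappa>"
      using c(3) by auto
    ultimately have "\<kappa> \<in> smooth_functions A" by simp
    then show ?thesis
      using c by (intro bexI[of _ \<kappa>]) auto
  qed
qed

section \<open>Tangent vectors in charts\<close>

lemma chart_vector_derivative:
  assumes U: "(U, \<phi>) \<in> A" and "p \<in> U" and u: "u \<in> smooth_functions A"
  shows "((u \<circ> inv_into U \<phi>) has_derivative (\<lambda>\<xi>. chart_vector A U \<phi> p \<xi> u)) (at (\<phi> p))"
proof -
  have "(u \<circ> inv_into U \<phi>) differentiable (at (\<phi> p))"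
    using smooth_function_Ck[OF u U, of 1] \<open>p \<in> U\<close> by simp
  moreover have "(\<lambda>\<xi>. chart_vector A U \<phi> p \<xi> u) = frechet_derivative (u \<circ> inv_into U \<phi>) (at (\<phi> p))"
    using u by (simp add: chart_vector_def fun_eq_iff)
  ultimately show ?thesis
    by (simp add: frechet_derivative_works)
qed

lemma chart_vector_add:
  assumes "(U, \<phi>) \<in> A" and "p \<in> U"
  shows "chart_vector A U \<phi> p (\<xi> + \<eta>) = chart_vector A U \<phi> p \<xi> + chart_vector A U \<phi> p \<eta>"
proof
  fix u
  show "chart_vector A U \<phi> p (\<xi> + \<eta>) u = (chart_vector A U \<phi> p \<xi> + chart_vector A U \<phi> p \<eta>) u"
  proof (cases "u \<in> smooth_functions A")
    case True
    then show ?thesis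
      using linear_add[OF has_derivative_linear[OF chart_vector_derivative[OF assms True]]] by simp
  qed (simp add: chart_vector_def)
qed

lemma chart_vector_scale:
  assumes "(U, \<phi>) \<in> A" and "p \<in> U"
  shows "chart_vector A U \<phi> p (r *\<^sub>R \<xi>) = r *\<^sub>T chart_vector A U \<phi> p \<xi>"
proof
  fix u
  show "chart_vector A U \<phi> p (r *\<^sub>R \<xi>) u = (r *\<^sub>T chart_vector A U \<phi> p \<xi>) u"
  proof (cases "u \<in> smooth_functions A")
    case True
    then show ?thesis
      using linear_cmul[OF has_derivative_linear[OF chart_vector_derivative[OF assms True]]]
      by (simp add: tscale_def)
  qed (simp add: chart_vector_def tscale_def)
qed

lemma chart_vector_zero:
  assumes "(U, \<phi>) \<in> A" and "p \<in> U"
  shows "chart_vector A U \<phi> p 0 = 0"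
  using chart_vector_scale[OF assms, of 0 0] by (simp add: tscale_def fun_eq_iff)

lemma chart_vector_sum:
  assumes "(U, \<phi>) \<in> A" and "p \<in> U"
  shows "chart_vector A U \<phi> p (\<Sum>i\<in>I. \<xi> i) = (\<Sum>i\<in>I. chart_vector A U \<phi> p (\<xi> i))"
  by (induction I rule: infinite_finite_induct)
     (auto simp: chart_vector_add[OF assms] chart_vector_zero[OF assms])

text \<open>The coordinate expression of the curve extends to a smooth map on an open set of parameters, even
at an end point of \<open>S\<close>.\<close>

lemma curve_in_chart_extends:
  assumes U: "(U, \<phi>) \<in> A" and t: "t \<in> S" "\<gamma> t \<in> U" and \<gamma>: "smooth_curve_on A S \<gamma>"
  shows "\<exists>V h. open V \<and> t \<in> V \<and> (\<forall>k. Ck_on k V h) \<and> h ` V \<subseteq> \<phi> ` U \<and>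
    (\<forall>s\<in>S \<inter> V. \<gamma> s \<in> U \<and> h s = \<phi> (\<gamma> s))"
proof -
  have cont: "continuous_on S \<gamma>" and sm: "smooth_on {t\<in>S. \<gamma> t \<in> U} (\<phi> \<circ> \<gamma>)"
    using \<gamma> U by (auto simp: smooth_curve_on_def dest: bspec)
  have "t \<in> {t\<in>S. \<gamma> t \<in> U}" using t by simp
  then have "\<exists>V h. open V \<and> t \<in> V \<and> (\<forall>k. Ck_on k V h) \<and> (\<forall>s\<in>{t\<in>S. \<gamma> t \<in> U} \<inter> V. h s = (\<phi> \<circ> \<gamma>) s)"
    using sm by (simp only: smooth_on_def)
  then obtain V h where V: "open V" "t \<in> V" "\<And>k. Ck_on k V h"
    and h: "\<And>s. s \<in> S \<Longrightarrow> \<gamma> s \<in> U \<Longrightarrow> s \<in> V \<Longrightarrow> h s = \<phi> (\<gamma> s)"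
    by auto
  obtain V' where V': "open V'" "S \<inter> \<gamma> -` U = S \<inter> V'"
    using continuous_openin_preimage_gen[OF cont chart_open[OF U]] by (auto simp: openin_open)
  let ?V = "(V \<inter> h -` (\<phi> ` U)) \<inter> V'"
  have "open (V \<inter> h -` (\<phi> ` U))"
    using V(3)[of 0] V(1) chart_image_open[OF U] by (intro continuous_open_preimage) simp_all
  then have "open ?V" using V'(1) by blast
  moreover have "t \<in> ?V" using V(2) V' t h[OF t V(2)] by auto
  moreover have "Ck_on k ?V h" for k by (rule Ck_on_subset[OF V(3)]) blast
  moreover have "h ` ?V \<subseteq> \<phi> ` U" by blast
  moreover have "\<gamma> s \<in> U \<and> h s = \<phi> (\<gamma> s)" if s: "s \<in> S \<inter> ?V" for s
  proof -
    have "\<gamma> s \<in> U" using s V'(2) by blast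
    then show ?thesis using s h by blast
  qed
  ultimately show ?thesis
    by (intro exI[of _ ?V] exI[of _ h]) blast
qed

lemma smooth_on_along_curve:
  assumes \<gamma>: "smooth_curve_on A S \<gamma>" and u: "u \<in> smooth_functions A"
  shows "smooth_on S (u \<circ> \<gamma>)"
  unfolding smooth_on_def
proof
  fix t assume t: "t \<in> S"
  obtain U \<phi> where U: "(U, \<phi>) \<in> A" "\<gamma> t \<in> U" by (rule chart_at)
  obtain V h where V: "open V" "t \<in> V" "\<forall>k. Ck_on k V h" "h ` V \<subseteq> \<phi> ` U"
    and h: "\<forall>s\<in>S \<inter> V. \<gamma> s \<in> U \<and> h s = \<phi> (\<gamma> s)"
    using curve_in_chart_extends[OF U(1) t U(2) \<gamma>] by (elim exE conjE)
  have "Ck_on k V (\<lambda>s. (u \<circ> inv_into U \<phi>) (h s))" for k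
    by (rule Ck_on_compose[OF V(1) chart_image_open[OF U(1)] V(4) _ smooth_function_Ck[OF u U(1)]])
       (use V(3) in simp)
  moreover have "(u \<circ> inv_into U \<phi>) (h s) = (u \<circ> \<gamma>) s" if "s \<in> S \<inter> V" for s
    using h that chart_inv[OF U(1)] by simp
  ultimately show "\<exists>V F. open V \<and> t \<in> V \<and> (\<forall>k. Ck_on k V F) \<and> (\<forall>s\<in>S \<inter> V. F s = (u \<circ> \<gamma>) s)"
    using V(1,2) by (intro exI[of _ V] exI[of _ "\<lambda>s. (u \<circ> inv_into U \<phi>) (h s)"]) simp
qed

text \<open>The chain rule for \<open>u \<circ> \<gamma> = (u \<circ> \<phi>\<^sup>-\<^sup>1) \<circ> (\<phi> \<circ> \<gamma>)\<close>: the velocity is the chart vector of the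
derivative of the coordinate expression. The parameter set is arbitrary, so the lemma serves both the
curves that define tangent vectors and one-sided velocities on closed intervals.\<close>

lemma velocity_in_chart:
  assumes U: "(U, \<phi>) \<in> A" and t: "t \<in> S" "at t within S \<noteq> bot" "\<gamma> t \<in> U"
    and \<gamma>: "smooth_curve_on A S \<gamma>"
  obtains \<xi> where "((\<phi> \<circ> \<gamma>) has_vector_derivative \<xi>) (at t within S)"
    and "\<And>u. u \<in> smooth_functions A \<Longrightarrow>
        ((u \<circ> \<gamma>) has_vector_derivative chart_vector A U \<phi> (\<gamma> t) \<xi> u) (at t within S)"
    and "velocity A S \<gamma> t = chart_vector A U \<phi> (\<gamma> t) \<xi>"
proof -
  obtain V h where V: "open V" "t \<in> V" "\<forall>k. Ck_on k V h"
    and h: "\<forall>s\<in>S \<inter> V. \<gamma> s \<in> U \<and> h s = \<phi> (\<gamma> s)"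
    using curve_in_chart_extends[OF U t(1,3) \<gamma>] by (elim exE conjE)
  obtain d where d: "d > 0" "ball t d \<subseteq> V"
    using V(1,2) open_contains_ball by blast
  have near: "\<gamma> s \<in> U \<and> h s = \<phi> (\<gamma> s)" if "s \<in> S" "dist s t < d" for s
    using that d h by (auto simp: dist_commute subset_iff)
  define \<xi> where "\<xi> = vector_derivative h (at t)"
  have "h differentiable (at t)"
    using V(3)[rule_format, of 1] V(2) by simp
  then have "(h has_vector_derivative \<xi>) (at t)"
    by (simp add: \<xi>_def vector_derivative_works)
  then have hS: "(h has_vector_derivative \<xi>) (at t within S)"
    by (rule has_vector_derivative_at_within)
  show ?thesis
  proof
    show "((\<phi> \<circ> \<gamma>) has_vector_derivative \<xi>) (at t within S)"
      by (rule has_vector_derivative_transform_within[OF hS d(1) t(1)]) (use near in auto)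
    show D: "((u \<circ> \<gamma>) has_vector_derivative chart_vector A U \<phi> (\<gamma> t) \<xi> u) (at t within S)"
      if u: "u \<in> smooth_functions A" for u
    proof -
      let ?F = "\<lambda>\<xi>. chart_vector A U \<phi> (\<gamma> t) \<xi> u"
      have F: "((u \<circ> inv_into U \<phi>) has_derivative ?F) (at (h t))"
        using chart_vector_derivative[OF U t(3) u] near[OF t(1)] d(1) by simp
      have "((\<lambda>s. (u \<circ> inv_into U \<phi>) (h s)) has_derivative (\<lambda>x. ?F (x *\<^sub>R \<xi>))) (at t within S)"
        by (rule has_derivative_compose[OF hS[unfolded has_vector_derivative_def] F])
      moreover have "?F (x *\<^sub>R \<xi>) = x *\<^sub>R ?F \<xi>" for x
        using linear_cmul[OF has_derivative_linear[OF F]] .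
      ultimately have "((\<lambda>s. (u \<circ> inv_into U \<phi>) (h s)) has_vector_derivative ?F \<xi>) (at t within S)"
        by (simp add: has_vector_derivative_def)
      then show ?thesis
        by (rule has_vector_derivative_transform_within[OF _ d(1) t(1)])
           (use near chart_inv[OF U] in auto)
    qed
    show "velocity A S \<gamma> t = chart_vector A U \<phi> (\<gamma> t) \<xi>"
    proof
      fix u
      show "velocity A S \<gamma> t u = chart_vector A U \<phi> (\<gamma> t) \<xi> u"
      proof (cases "u \<in> smooth_functions A")
        case True
        then show ?thesis
          using vector_derivative_within[OF t(2) D[OF True]] by (simp add: velocity_def)
      qed (simp add: velocity_def chart_vector_def)
    qed
  qed
qed

text \<open>It is the velocity of the curve with coordinates \<open>\<phi> p + s \<xi>\<close>.\<close>

lemma chart_vector_in_tangent_space: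
  assumes U: "(U, \<phi>) \<in> A" and p: "p \<in> U"
  shows "chart_vector A U \<phi> p \<xi> \<in> tangent_space A p"
proof -
  let ?l = "\<lambda>s::real. \<phi> p + s *\<^sub>R \<xi>"
  have contl: "continuous_on S ?l" for S by (intro continuous_intros)
  have "open (?l -` (\<phi> ` U))"
    using chart_image_open[OF U] contl by (rule open_vimage)
  moreover have "0 \<in> ?l -` (\<phi> ` U)" using p by simp
  ultimately obtain e where e: "e > 0" "ball 0 e \<subseteq> ?l -` (\<phi> ` U)"
    using open_contains_ball by blast
  have inU: "?l s \<in> \<phi> ` U" if "s \<in> {-e<..<e}" for s
    using e(2) that by (auto simp: subset_iff dist_real_def)
  define \<gamma> where "\<gamma> s = inv_into U \<phi> (?l s)" for s
  have \<gamma>U: "\<gamma> s \<in> U" "\<phi> (\<gamma> s) = ?l s" if "s \<in> {-e<..<e}" for s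
    using inU[OF that] unfolding \<gamma>_def by (auto intro: inv_into_into simp: f_inv_into_f)
  have cont: "continuous_on {-e<..<e} \<gamma>"
    unfolding \<gamma>_def by (rule continuous_on_compose2[OF chart_inv_cont[OF U] contl]) (use inU in auto)
  have "smooth_on {s \<in> {-e<..<e}. \<gamma> s \<in> W} (\<psi> \<circ> \<gamma>)" if W: "(W, \<psi>) \<in> A" for W \<psi>
  proof -
    have eq: "{s \<in> {-e<..<e}. \<gamma> s \<in> W} = {-e<..<e} \<inter> \<gamma> -` W" by auto
    have op: "open {s \<in> {-e<..<e}. \<gamma> s \<in> W}"
      unfolding eq using cont chart_open[OF W] by (intro continuous_open_preimage) auto
    have op2: "open (\<phi> ` (U \<inter> W))"
      using chart_open[OF U] chart_open[OF W] by (auto intro: chart_open_image[OF U])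
    have sub: "?l ` {s \<in> {-e<..<e}. \<gamma> s \<in> W} \<subseteq> \<phi> ` (U \<inter> W)"
    proof
      fix y assume "y \<in> ?l ` {s \<in> {-e<..<e}. \<gamma> s \<in> W}"
      then obtain s where "s \<in> {-e<..<e}" "\<gamma> s \<in> W" "y = ?l s" by blast
      with \<gamma>U[of s] show "y \<in> \<phi> ` (U \<inter> W)" by (metis IntI image_eqI)
    qed
    have "Ck_on k {s \<in> {-e<..<e}. \<gamma> s \<in> W} ?l" for k
      by (rule Ck_on_add[OF op Ck_on_const[OF op] Ck_on_linear[OF op bounded_linear_scaleR_left]])
    then have "Ck_on k {s \<in> {-e<..<e}. \<gamma> s \<in> W} (\<lambda>s. (\<psi> \<circ> inv_into U \<phi>) (?l s))" for k
      by (rule Ck_on_compose[OF op op2 sub _ transition_Ck[OF U W]])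
    moreover have "\<psi> \<circ> \<gamma> = (\<lambda>s. (\<psi> \<circ> inv_into U \<phi>) (?l s))"
      by (simp add: \<gamma>_def fun_eq_iff)
    ultimately show ?thesis
      by (simp only: smooth_on_open[OF op] simp_thms)
  qed
  then have sm: "smooth_curve_on A {-e<..<e} \<gamma>"
    using cont by (auto simp: smooth_curve_on_def)
  have \<gamma>0: "\<gamma> 0 = p" using chart_inv[OF U p] by (simp add: \<gamma>_def)
  have nb: "at (0::real) within {-e<..<e} \<noteq> bot" and in0: "0 \<in> {-e<..<e}"
    using e(1) at_within_open[of 0 "{-e<..<e}"] by auto
  have g0U: "\<gamma> 0 \<in> U" using \<gamma>0 p by simp
  from velocity_in_chart[OF U in0 nb g0U sm] obtain \<eta> where
    \<eta>: "((\<phi> \<circ> \<gamma>) has_vector_derivative \<eta>) (at 0 within {-e<..<e})"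
      "velocity A {-e<..<e} \<gamma> 0 = chart_vector A U \<phi> (\<gamma> 0) \<eta>" by metis
  have "(?l has_vector_derivative 0 + 1 *\<^sub>R \<xi>) (at 0 within {-e<..<e})"
    by (intro has_vector_derivative_add has_vector_derivative_const)
       (auto intro!: derivative_eq_intros)
  then have "((\<phi> \<circ> \<gamma>) has_vector_derivative \<xi>) (at 0 within {-e<..<e})"
    by (intro has_vector_derivative_transform_within[OF _ zero_less_one in0, of ?l \<xi> "\<phi> \<circ> \<gamma>"])
       (simp_all add: \<gamma>U(2))
  then have "\<eta> = \<xi>"
    using \<eta>(1) nb vector_derivative_unique_within by blast
  then have "chart_vector A U \<phi> p \<xi> = velocity A {-e<..<e} \<gamma> 0"
    using \<eta>(2) \<gamma>0 by simp
  then show ?thesis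
    using e(1) sm \<gamma>0 unfolding tangent_space_def by blast
qed

text \<open>Since chart vectors are linear in \<open>\<xi>\<close>, this makes the tangent space a vector space, which is not
evident from the definition by velocities of curves.\<close>

lemma tangent_space_eq_range:
  assumes U: "(U, \<phi>) \<in> A" and p: "p \<in> U"
  shows "tangent_space A p = range (chart_vector A U \<phi> p)"
proof
  show "tangent_space A p \<subseteq> range (chart_vector A U \<phi> p)"
  proof
    fix v assume "v \<in> tangent_space A p"
    then obtain e \<gamma> where e: "e > 0" "smooth_curve_on A {-e<..<e} \<gamma>" "\<gamma> 0 = p"
      "v = velocity A {-e<..<e} \<gamma> 0"
      by (auto simp: tangent_space_def)
    have nb: "at (0::real) within {-e<..<e} \<noteq> bot" and in0: "0 \<in> {-e<..<e}"
      using e(1) at_within_open[of 0 "{-e<..<e}"] by auto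
    have g0U: "\<gamma> 0 \<in> U" using e p by simp
    obtain \<xi> where "velocity A {-e<..<e} \<gamma> 0 = chart_vector A U \<phi> (\<gamma> 0) \<xi>"
      by (rule velocity_in_chart[OF U in0 nb g0U e(2)])
    then show "v \<in> range (chart_vector A U \<phi> p)"
      using e by simp
  qed
qed (use chart_vector_in_tangent_space[OF assms] in blast)

lemma tangent_add:
  assumes "v \<in> tangent_space A p" "w \<in> tangent_space A p"
  shows "v + w \<in> tangent_space A p"
proof -
  obtain U \<phi> where U: "(U, \<phi>) \<in> A" "p \<in> U" by (rule chart_at)
  from assms obtain \<xi> \<eta> where "v = chart_vector A U \<phi> p \<xi>" "w = chart_vector A U \<phi> p \<eta>"
    unfolding tangent_space_eq_range[OF U] by blast
  then have "v + w = chart_vector A U \<phi> p (\<xi> + \<eta>)"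
    by (simp add: chart_vector_add[OF U])
  then show ?thesis
    unfolding tangent_space_eq_range[OF U] by blast
qed

lemma tangent_scale:
  assumes "v \<in> tangent_space A p"
  shows "r *\<^sub>T v \<in> tangent_space A p"
proof -
  obtain U \<phi> where U: "(U, \<phi>) \<in> A" "p \<in> U" by (rule chart_at)
  from assms obtain \<xi> where "v = chart_vector A U \<phi> p \<xi>"
    unfolding tangent_space_eq_range[OF U] by blast
  then have "r *\<^sub>T v = chart_vector A U \<phi> p (r *\<^sub>R \<xi>)"
    by (simp add: chart_vector_scale[OF U])
  then show ?thesis
    unfolding tangent_space_eq_range[OF U] by blast
qed

lemma tangent_zero: "0 \<in> tangent_space A p"
proof -
  obtain U \<phi> where U: "(U, \<phi>) \<in> A" "p \<in> U" by (rule chart_at)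
  show ?thesis
    using chart_vector_in_tangent_space[OF U, of 0] by (simp add: chart_vector_zero[OF U])
qed

lemma tangent_sum: "(\<And>i. i \<in> I \<Longrightarrow> f i \<in> tangent_space A p) \<Longrightarrow> (\<Sum>i\<in>I. f i) \<in> tangent_space A p"
  by (induction I rule: infinite_finite_induct) (auto intro: tangent_zero tangent_add)

lemma tangent_diff:
  assumes "v \<in> tangent_space A p" "w \<in> tangent_space A p"
  shows "v - w \<in> tangent_space A p"
proof -
  have eq: "v - w = v + (-1) *\<^sub>T w" by (auto simp: tscale_def fun_eq_iff)
  show ?thesis
    unfolding eq by (rule tangent_add[OF assms(1) tangent_scale[OF assms(2)]])
qed

section \<open>Vector fields, local frames and connections\<close>

lemma vector_field_tangent: "X \<in> vector_fields A \<Longrightarrow> X p \<in> tangent_space A p"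
  by (simp add: vector_fields_def)

lemma vector_field_act: "X \<in> vector_fields A \<Longrightarrow> u \<in> smooth_functions A \<Longrightarrow> (\<lambda>p. X p u) \<in> smooth_functions A"
  by (simp add: vector_fields_def act_def)

lemma vector_field_zero: "0 \<in> vector_fields A"
  by (simp add: vector_fields_def tangent_zero act_def smooth_function_const)

lemma vector_field_add:
  assumes "X \<in> vector_fields A" "Y \<in> vector_fields A"
  shows "X + Y \<in> vector_fields A"
  using assms by (auto simp: vector_fields_def act_def intro: tangent_add smooth_function_add)

lemma vector_field_fscale:
  assumes "h \<in> smooth_functions A" "X \<in> vector_fields A"
  shows "h *\<^sub>F X \<in> vector_fields A"
  using assms by (auto simp: vector_fields_def act_def fscale_def tscale_def
      intro: tangent_scale[unfolded tscale_def] smooth_function_mult)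

lemma vector_field_sum:
  "(\<And>i. i \<in> I \<Longrightarrow> X i \<in> vector_fields A) \<Longrightarrow> (\<Sum>i\<in>I. X i) \<in> vector_fields A"
  by (induction I rule: infinite_finite_induct) (auto intro: vector_field_zero vector_field_add)

text \<open>The fields \<open>E b\<close> are the coordinate fields and the functions \<open>u b\<close> the coordinates, both cut off by
one bump function that equals \<open>1\<close> on \<open>N\<close>. Evaluation at \<open>u b\<close> reads off the components of a
tangent vector, so the components of a vector field are smooth functions defined globally.\<close>

lemma local_frame:
  obtains N E u where "open N" "p \<in> N"
    "\<And>b. b \<in> (Basis :: 'e set) \<Longrightarrow> E b \<in> vector_fields A"
    "\<And>b. b \<in> (Basis :: 'e set) \<Longrightarrow> u b \<in> smooth_functions A"
    "\<And>q v. q \<in> N \<Longrightarrow> v \<in> tangent_space A q \<Longrightarrow> v = (\<Sum>b\<in>(Basis :: 'e set). v (u b) *\<^sub>T E b q)"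
proof -
  obtain U \<phi> where U: "(U, \<phi>) \<in> A" "p \<in> U" by (rule chart_at)
  have opU: "open U" "U \<subseteq> U" using chart_open U by auto
  show ?thesis
  proof (rule bump_in_chart[OF U(1) opU(1) U(2) opU(2)])
    fix \<kappa> N
    assume N: "open N" "p \<in> N" "N \<subseteq> U" "\<And>q. q \<in> N \<Longrightarrow> \<kappa> q = (1::real)"
      and ext: "\<And>h. (\<And>k. Ck_on k (\<phi> ` U) h) \<Longrightarrow> (\<lambda>q. if q \<in> U then \<kappa> q * h (\<phi> q) else 0) \<in> smooth_functions A"
    define u where "u b q = (if q \<in> U then \<kappa> q * (\<phi> q \<bullet> b) else 0)" for b :: 'e and q
    define E where "E b q = (if q \<in> U then \<kappa> q *\<^sub>T chart_vector A U \<phi> q b else 0)" for b :: 'e and q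
    have opI: "open (\<phi> ` U)" using chart_image_open U by blast
    show ?thesis
    proof (rule that[OF N(1,2)])
      show usm: "u b \<in> smooth_functions A" for b
        unfolding u_def[abs_def] using Ck_on_linear[OF opI bounded_linear_inner_left] by (rule ext)
      show "E b \<in> vector_fields A" for b
        unfolding vector_fields_def
      proof (intro CollectI conjI allI ballI)
        show "E b q \<in> tangent_space A q" for q
          using tangent_zero tangent_scale chart_vector_in_tangent_space[OF U(1)] by (simp add: E_def)
        fix w assume w: "w \<in> smooth_functions A"
        have "Ck_on k (\<phi> ` U) (\<lambda>x. frechet_derivative (w \<circ> inv_into U \<phi>) (at x) b)" for k
          using smooth_function_Ck[OF w U(1), of "Suc k"] by simp
        then have "(\<lambda>q. if q \<in> U then \<kappa> q * frechet_derivative (w \<circ> inv_into U \<phi>) (at (\<phi> q)) b else 0) \<in> smooth_functions A"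
          by (rule ext)
        moreover have "act (E b) w = (\<lambda>q. if q \<in> U then \<kappa> q * frechet_derivative (w \<circ> inv_into U \<phi>) (at (\<phi> q)) b else 0)"
          using w by (auto simp: act_def E_def tscale_def chart_vector_def)
        ultimately show "act (E b) w \<in> smooth_functions A" by simp
      qed
      fix q v assume q: "q \<in> N" and v: "v \<in> tangent_space A q"
      have qU: "q \<in> U" using q N by blast
      from v obtain \<xi> where \<xi>: "v = chart_vector A U \<phi> q \<xi>"
        unfolding tangent_space_eq_range[OF U(1) qU] by blast
      have opN: "open (\<phi> ` N)" using chart_open_image U N by blast
      have coord: "v (u b) = \<xi> \<bullet> b" for b
      proof -
        have "((\<lambda>x. x \<bullet> b) has_derivative (\<lambda>\<xi>. \<xi> \<bullet> b)) (at (\<phi> q))"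
          by (auto intro!: derivative_eq_intros)
        then have "((u b \<circ> inv_into U \<phi>) has_derivative (\<lambda>\<xi>. \<xi> \<bullet> b)) (at (\<phi> q))"
          by (rule has_derivative_transform_within_open[OF _ opN])
             (use q N chart_inv[OF U(1)] in \<open>auto simp: u_def\<close>)
        then have "(\<lambda>\<xi>. \<xi> \<bullet> b) = (\<lambda>\<xi>. chart_vector A U \<phi> q \<xi> (u b))"
          using chart_vector_derivative[OF U(1) qU usm] has_derivative_unique by blast
        then show ?thesis by (simp add: \<xi> fun_eq_iff)
      qed
      have "v = chart_vector A U \<phi> q (\<Sum>b\<in>Basis. (\<xi> \<bullet> b) *\<^sub>R b)"
        by (simp add: \<xi> euclidean_representation)
      also have "\<dots> = (\<Sum>b\<in>Basis. (\<xi> \<bullet> b) *\<^sub>T chart_vector A U \<phi> q b)"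
        by (simp add: chart_vector_sum[OF U(1) qU] chart_vector_scale[OF U(1) qU])
      also have "\<dots> = (\<Sum>b\<in>Basis. v (u b) *\<^sub>T E b q)"
        using q N qU by (simp add: coord E_def tscale_def)
      finally show "v = (\<Sum>b\<in>Basis. v (u b) *\<^sub>T E b q)" .
    qed
  qed
qed

lemma connection_vector_field:
  "affine_connection A D \<Longrightarrow> X \<in> vector_fields A \<Longrightarrow> Y \<in> vector_fields A \<Longrightarrow> D X Y \<in> vector_fields A"
  by (simp add: affine_connection_def)

lemma connection_sum:
  assumes D: "affine_connection A D" and Y: "Y \<in> vector_fields A"
    and "\<And>i. i \<in> I \<Longrightarrow> h i \<in> smooth_functions A" "\<And>i. i \<in> I \<Longrightarrow> X i \<in> vector_fields A"
  shows "D (\<Sum>i\<in>I. h i *\<^sub>F X i) Y = (\<Sum>i\<in>I. h i *\<^sub>F D (X i) Y)"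
proof -
  have add: "D (X + Z) Y = D X Y + D Z Y" if "X \<in> vector_fields A" "Z \<in> vector_fields A" for X Z
    using D that Y by (simp add: affine_connection_def)
  have zero: "D 0 Y = 0"
    using add[OF vector_field_zero vector_field_zero] by simp
  show ?thesis
    using assms(3,4)
  proof (induction I rule: infinite_finite_induct)
    case (insert i I)
    have "D (h i *\<^sub>F X i) Y = h i *\<^sub>F D (X i) Y"
      using D Y insert.prems[of i] by (simp add: affine_connection_def)
    moreover have "h i *\<^sub>F X i \<in> vector_fields A" "(\<Sum>i\<in>I. h i *\<^sub>F X i) \<in> vector_fields A"
      using insert.prems by (auto intro!: vector_field_fscale vector_field_sum)
    moreover have "D (\<Sum>i\<in>I. h i *\<^sub>F X i) Y = (\<Sum>i\<in>I. h i *\<^sub>F D (X i) Y)"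
      using insert by blast
    ultimately show ?case
      by (simp only: sum.insert[OF insert.hyps] add)
  qed (auto simp: zero)
qed

text \<open>The value of \<open>\<nabla>\<^sub>X Y\<close> at \<open>p\<close> is linear over functions in \<open>X\<close>, so it depends only on the components of
\<open>X\<close> at \<open>p\<close>. As \<open>D\<close> acts on global fields, the frame expansion of \<open>X\<close> is first made global: a
smooth function \<open>\<kappa>\<close> that vanishes off \<open>N\<close>, with \<open>\<kappa> p = 1\<close>, gives
\<open>\<kappa> X = \<Sum>\<^sub>b (\<kappa> X(u\<^sub>b)) E\<^sub>b\<close> everywhere.\<close>

lemma connection_in_frame:
  assumes D: "affine_connection A D" and X: "X \<in> vector_fields A" and Y: "Y \<in> vector_fields A"
    and N: "open N" "p \<in> N"
    and E: "\<And>b. b \<in> (Basis :: 'e set) \<Longrightarrow> E b \<in> vector_fields A"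
    and u: "\<And>b. b \<in> (Basis :: 'e set) \<Longrightarrow> u b \<in> smooth_functions A"
    and frame: "\<And>q v. q \<in> N \<Longrightarrow> v \<in> tangent_space A q \<Longrightarrow> v = (\<Sum>b\<in>(Basis :: 'e set). v (u b) *\<^sub>T E b q)"
  shows "D X Y p = (\<Sum>b\<in>(Basis :: 'e set). X p (u b) *\<^sub>T D (E b) Y p)"
proof -
  obtain \<kappa> where \<kappa>: "\<kappa> \<in> smooth_functions A" "\<kappa> p = 1" "\<And>q. q \<notin> N \<Longrightarrow> \<kappa> q = 0"
    using bump_function[OF N] by auto
  define h where "h b q = \<kappa> q * X q (u b)" for b q
  have h: "h b \<in> smooth_functions A" if "b \<in> Basis" for b
    unfolding h_def[abs_def] by (rule smooth_function_mult[OF \<kappa>(1) vector_field_act[OF X u[OF that]]])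
  have "\<kappa> *\<^sub>F X = (\<Sum>b\<in>Basis. h b *\<^sub>F E b)"
  proof
    fix q
    have "(\<Sum>b\<in>Basis. h b *\<^sub>F E b) q = \<kappa> q *\<^sub>T (\<Sum>b\<in>Basis. X q (u b) *\<^sub>T E b q)"
      by (simp add: sum_fun_apply fscale_def h_def tscale_sum) (simp add: tscale_def mult.assoc)
    also have "\<dots> = (\<kappa> *\<^sub>F X) q"
    proof (cases "q \<in> N")
      case True
      then show ?thesis
        using frame[OF True vector_field_tangent[OF X]] by (simp add: fscale_def)
    qed (simp add: fscale_def tscale_def \<kappa>(3))
    finally show "(\<kappa> *\<^sub>F X) q = (\<Sum>b\<in>Basis. h b *\<^sub>F E b) q" by simp
  qed
  then have "D (\<kappa> *\<^sub>F X) Y = (\<Sum>b\<in>Basis. h b *\<^sub>F D (E b) Y)"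
    using connection_sum[OF D Y, of Basis h E] h E by simp
  moreover have "D (\<kappa> *\<^sub>F X) Y = \<kappa> *\<^sub>F D X Y"
    using D \<kappa>(1) X Y by (simp add: affine_connection_def)
  ultimately have "(\<kappa> *\<^sub>F D X Y) p = (\<Sum>b\<in>Basis. h b *\<^sub>F D (E b) Y) p" by simp
  then show ?thesis
    by (simp add: fscale_def sum_fun_apply h_def \<kappa>(2)) (simp add: tscale_def)
qed

text \<open>So the covariant derivative along a curve does not depend on the extension of the velocity to a
vector field.\<close>

lemma connection_pointwise:
  assumes "affine_connection A D" "X \<in> vector_fields A" "X' \<in> vector_fields A" "Y \<in> vector_fields A"
    and "X p = X' p"
  shows "D X Y p = D X' Y p"
proof (rule local_frame)
  fix N E u
  assume *: "open N" "p \<in> N" "\<And>b. b \<in> (Basis :: 'e set) \<Longrightarrow> E b \<in> vector_fields A"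
    "\<And>b. b \<in> (Basis :: 'e set) \<Longrightarrow> u b \<in> smooth_functions A"
    "\<And>q v. q \<in> N \<Longrightarrow> v \<in> tangent_space A q \<Longrightarrow> v = (\<Sum>b\<in>(Basis :: 'e set). v (u b) *\<^sub>T E b q)"
  show ?thesis
    using connection_in_frame[OF assms(1,2,4) *] connection_in_frame[OF assms(1,3,4) *] assms(5)
    by simp
qed

section \<open>Velocities and restriction of covariant derivatives\<close>

lemma velocity_derivative:
  assumes \<gamma>: "smooth_curve_on A S \<gamma>" and t: "t \<in> S" "at t within S \<noteq> bot" and u: "u \<in> smooth_functions A"
  shows "((u \<circ> \<gamma>) has_vector_derivative velocity A S \<gamma> t u) (at t within S)"
proof (rule chart_at[of "\<gamma> t"])
  fix U \<phi> assume U: "(U, \<phi>) \<in> A" "\<gamma> t \<in> U"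
  show ?thesis
    by (rule velocity_in_chart[OF U(1) t U(2) \<gamma>]) (use u in simp)
qed

lemma velocity_tangent:
  assumes \<gamma>: "smooth_curve_on A S \<gamma>" and t: "t \<in> S" "at t within S \<noteq> bot"
  shows "velocity A S \<gamma> t \<in> tangent_space A (\<gamma> t)"
proof (rule chart_at[of "\<gamma> t"])
  fix U \<phi> assume U: "(U, \<phi>) \<in> A" "\<gamma> t \<in> U"
  show ?thesis
    by (rule velocity_in_chart[OF U(1) t U(2) \<gamma>]) (simp add: chart_vector_in_tangent_space[OF U])
qed

text \<open>One-sided and two-sided velocities agree, so covariant derivatives may be restricted to smaller
intervals; this reconciles fields that are parallel with respect to different partitions.\<close>

lemma velocity_subset:
  assumes \<gamma>: "smooth_curve_on A S \<gamma>" and "T \<subseteq> S" and t: "t \<in> T" "at t within T \<noteq> bot"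
  shows "velocity A T \<gamma> t = velocity A S \<gamma> t"
proof
  fix u
  have tS: "t \<in> S" "at t within S \<noteq> bot"
    using assms(2) t at_le[OF assms(2), of t] by (auto simp: le_bot)
  show "velocity A T \<gamma> t u = velocity A S \<gamma> t u"
  proof (cases "u \<in> smooth_functions A")
    case True
    have "((u \<circ> \<gamma>) has_vector_derivative velocity A S \<gamma> t u) (at t within T)"
      by (rule has_vector_derivative_within_subset[OF velocity_derivative[OF \<gamma> tS True] assms(2)])
    then show ?thesis
      using vector_derivative_within[OF t(2)] True by (simp add: velocity_def)
  qed (simp add: velocity_def)
qed

lemma tangent_vector_extension:
  assumes v: "v \<in> tangent_space A p"
  shows "\<exists>X\<in>vector_fields A. X p = v"
proof (rule local_frame[of p])
  fix N E u
  assume *: "open N" "p \<in> N" "\<And>b. b \<in> (Basis :: 'e set) \<Longrightarrow> E b \<in> vector_fields A"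
    "\<And>b. b \<in> (Basis :: 'e set) \<Longrightarrow> u b \<in> smooth_functions A"
    "\<And>q v. q \<in> N \<Longrightarrow> v \<in> tangent_space A q \<Longrightarrow> v = (\<Sum>b\<in>(Basis :: 'e set). v (u b) *\<^sub>T E b q)"
  let ?X = "\<Sum>b\<in>Basis. (\<lambda>_. v (u b)) *\<^sub>F E b"
  have "?X \<in> vector_fields A"
    by (rule vector_field_sum[OF vector_field_fscale[OF smooth_function_const *(3)]])
  moreover have "?X p = v"
    using *(5)[OF *(2) v] by (simp add: sum_fun_apply fscale_def)
  ultimately show ?thesis by blast
qed

lemma has_covariant_derivative_subset:
  assumes V: "has_covariant_derivative A D S \<gamma> V w t" and \<gamma>: "smooth_curve_on A S \<gamma>"
    and T: "T \<subseteq> S" "t \<in> T" "at t within T \<noteq> bot"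
  shows "has_covariant_derivative A D T \<gamma> V w t"
proof (rule has_covariant_derivativeE[OF V])
  fix n :: nat and Y f f' X \<epsilon>
  assume *: "\<And>i. i < n \<Longrightarrow> Y i \<in> vector_fields A"
    "\<And>i. i < n \<Longrightarrow> (f i has_real_derivative f' i) (at t within S)"
    "\<epsilon> > 0" "\<And>s. s \<in> S \<Longrightarrow> \<bar>s - t\<bar> < \<epsilon> \<Longrightarrow> V s = (\<Sum>i<n. f i s *\<^sub>T Y i (\<gamma> s))"
    "X \<in> vector_fields A" "X (\<gamma> t) = velocity A S \<gamma> t"
    "w = (\<Sum>i<n. f' i *\<^sub>T Y i (\<gamma> t) + f i t *\<^sub>T D X (Y i) (\<gamma> t))"
  show ?thesis
    unfolding has_covariant_derivative_def
  proof (intro exI[of _ n] exI[of _ Y] exI[of _ f] exI[of _ f'] exI[of _ X] conjI)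
    show "\<forall>i<n. Y i \<in> vector_fields A \<and> (f i has_real_derivative f' i) (at t within T)"
      using *(1) DERIV_subset[OF *(2) T(1)] by blast
    show "\<exists>\<epsilon>>0. \<forall>s\<in>T. \<bar>s - t\<bar> < \<epsilon> \<longrightarrow> V s = (\<Sum>i<n. f i s *\<^sub>T Y i (\<gamma> s))"
      using *(3,4) T(1) by blast
    show "X (\<gamma> t) = velocity A T \<gamma> t"
      using *(6) velocity_subset[OF \<gamma> T] by simp
  qed (rule *)+
qed

lemma parallel_along_tangent:
  assumes V: "parallel_along A D a b \<gamma> V" and t: "a < b" "t \<in> {a..b}"
  shows "V t \<in> tangent_space A (\<gamma> t)"
proof -
  have "\<exists>l r. t \<in> {l..r} \<and> has_covariant_derivative A D {l..r} \<gamma> V 0 t"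
  proof (cases "t < b")
    case True
    have "a \<le> t" using t by simp
    from parallel_along_right[OF V this True] obtain l r where "l \<le> t" "t < r"
      "\<forall>t\<in>{l..r}. has_covariant_derivative A D {l..r} \<gamma> V 0 t" by blast
    then show ?thesis by (intro exI[of _ l] exI[of _ r]) simp
  next
    case False
    then have "a < t" "t \<le> b" using t by simp_all
    from parallel_along_left[OF V this] obtain l r where "l < t" "t \<le> r"
      "\<forall>t\<in>{l..r}. has_covariant_derivative A D {l..r} \<gamma> V 0 t" by blast
    then show ?thesis by (intro exI[of _ l] exI[of _ r]) simp
  qed
  then obtain l r where l: "t \<in> {l..r}" "has_covariant_derivative A D {l..r} \<gamma> V 0 t" by blast
  show ?thesis
  proof (rule has_covariant_derivativeE[OF l(2)])
    fix n :: nat and Y f f' X \<epsilon>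
    assume *: "\<And>i. i < n \<Longrightarrow> Y i \<in> vector_fields A" "\<epsilon> > 0"
      "\<And>s. s \<in> {l..r} \<Longrightarrow> \<bar>s - t\<bar> < \<epsilon> \<Longrightarrow> V s = (\<Sum>i<n. f i s *\<^sub>T Y i (\<gamma> s))"
    have "V t = (\<Sum>i<n. f i t *\<^sub>T Y i (\<gamma> t))" using *(3)[OF l(1)] *(2) by simp
    also have "\<dots> \<in> tangent_space A (\<gamma> t)"
      using *(1) by (intro tangent_sum tangent_scale vector_field_tangent) simp
    finally show ?thesis .
  qed
qed

section \<open>Existence of parallel fields\<close>

text \<open>Near \<open>x\<close> the curve stays in the domain of a frame \<open>E\<close>. For \<open>V = \<Sum>\<^sub>i y\<^sub>i (E\<^sub>i \<circ> \<gamma>)\<close> the covariant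
derivative vanishes if \<open>y' = - C y\<close>, where the matrix \<open>C\<close> is defined by
\<open>\<nabla>\<^bsub>\<gamma>'\<^esub> E\<^sub>i = \<Sum>\<^sub>k C\<^sub>k\<^sub>i E\<^sub>k\<close>. Its entries are continuous because the curve is \<open>C\<^sup>1\<close>, hence
bounded on the compact interval, and the equation is solvable on intervals whose length is bounded
in terms of that bound.\<close>

lemma transportable_short:
  assumes D: "affine_connection A D" and ab: "a < b" and \<gamma>: "smooth_curve_on A {a..b} \<gamma>" and x: "x \<in> {a..b}"
  shows "\<exists>\<delta>>0. \<forall>c d. a \<le> c \<and> c \<le> x \<and> x \<le> d \<and> d \<le> b \<and> c < d \<and> d - c < \<delta> \<longrightarrow> transportable A D \<gamma> c d"
proof (rule local_frame[of "\<gamma> x"])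
  fix N E u
  assume N: "open N" "\<gamma> x \<in> N" and E: "\<And>b. b \<in> (Basis :: 'e set) \<Longrightarrow> E b \<in> vector_fields A"
    and u: "\<And>b. b \<in> (Basis :: 'e set) \<Longrightarrow> u b \<in> smooth_functions A"
    and frame: "\<And>q v. q \<in> N \<Longrightarrow> v \<in> tangent_space A q \<Longrightarrow> v = (\<Sum>b\<in>(Basis :: 'e set). v (u b) *\<^sub>T E b q)"
  have cont: "continuous_on {a..b} \<gamma>" using \<gamma> by (simp add: smooth_curve_on_def)
  define C where "C k i t = (\<Sum>j\<in>Basis. velocity A {a..b} \<gamma> t (u j) * D (E j) (E i) (\<gamma> t) (u k))" for k i t
  have C_cont: "continuous_on {a..b} (C k i)" if "k \<in> Basis" "i \<in> Basis" for k i
    unfolding C_def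
  proof (intro continuous_on_sum continuous_on_mult)
    fix j :: 'e assume j: "j \<in> Basis"
    have "continuous_on {a..b} (\<lambda>t. vector_derivative (u j \<circ> \<gamma>) (at t within {a..b}))"
      by (rule smooth_on_interval_C1[OF ab smooth_on_along_curve[OF \<gamma> u[OF j]]])
    then show "continuous_on {a..b} (\<lambda>t. velocity A {a..b} \<gamma> t (u j))"
      using u[OF j] by (simp add: velocity_def)
    have "(\<lambda>p. D (E j) (E i) p (u k)) \<in> smooth_functions A"
      by (rule vector_field_act[OF connection_vector_field[OF D E[OF j] E[OF that(2)]] u[OF that(1)]])
    then show "continuous_on {a..b} (\<lambda>t. D (E j) (E i) (\<gamma> t) (u k))"
      by (intro continuous_on_compose2[OF smooth_function_cont cont]) auto
  qed
  have conn: "D X (E i) (\<gamma> t) = (\<Sum>k\<in>Basis. C k i t *\<^sub>T E k (\<gamma> t))"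
    if X: "X \<in> vector_fields A" "X (\<gamma> t) = velocity A {a..b} \<gamma> t" and t: "\<gamma> t \<in> N" and i: "i \<in> Basis" for X i t
  proof -
    have coef: "D X (E i) (\<gamma> t) (u k) = C k i t" for k
      using connection_in_frame[OF D X(1) E[OF i] N(1) t E u frame]
      by (simp add: C_def X(2) sum_fun_apply tscale_def)
    have "D X (E i) (\<gamma> t) \<in> tangent_space A (\<gamma> t)"
      by (rule vector_field_tangent[OF connection_vector_field[OF D X(1) E[OF i]]])
    then have "D X (E i) (\<gamma> t) = (\<Sum>k\<in>Basis. D X (E i) (\<gamma> t) (u k) *\<^sub>T E k (\<gamma> t))"
      by (rule frame[OF t])
    also have "\<dots> = (\<Sum>k\<in>Basis. C k i t *\<^sub>T E k (\<gamma> t))"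
      by (simp only: coef)
    finally show ?thesis .
  qed
  have "continuous_on {a..b} (\<lambda>t. \<Sum>k\<in>Basis. \<Sum>i\<in>Basis. \<bar>C k i t\<bar>)"
    by (intro continuous_on_sum continuous_on_rabs C_cont)
  then have "bounded ((\<lambda>t. \<Sum>k\<in>Basis. \<Sum>i\<in>Basis. \<bar>C k i t\<bar>) ` {a..b})"
    by (intro compact_imp_bounded compact_continuous_image compact_Icc)
  then obtain K where K0: "\<And>t. t \<in> {a..b} \<Longrightarrow> norm (\<Sum>k\<in>Basis. \<Sum>i\<in>Basis. \<bar>C k i t\<bar>) \<le> K"
    unfolding bounded_iff by blast
  have K: "(\<Sum>k\<in>Basis. \<Sum>i\<in>Basis. \<bar>C k i t\<bar>) \<le> K" if "t \<in> {a..b}" for t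
    using K0[OF that] by (simp add: sum_nonneg)
  have Kpos: "0 \<le> K" using K0[OF x] norm_ge_zero order_trans by blast
  define F where "F t y = - (\<Sum>k\<in>Basis. (\<Sum>i\<in>Basis. C k i t * (y \<bullet> i)) *\<^sub>R k)" for t and y :: 'e
  have F_lip: "norm (F t y - F t z) \<le> K * norm (y - z)" if t: "t \<in> {a..b}" for t y z
  proof -
    have "F t y - F t z = F t (y - z)"
      by (simp add: F_def inner_diff_left right_diff_distrib sum_subtractf scaleR_diff_left)
    also have "norm \<dots> \<le> (\<Sum>k\<in>Basis. norm ((\<Sum>i\<in>Basis. C k i t * ((y - z) \<bullet> i)) *\<^sub>R k))"
      unfolding F_def norm_minus_cancel by (rule norm_sum)
    also have "\<dots> = (\<Sum>k\<in>Basis. \<bar>\<Sum>i\<in>Basis. C k i t * ((y - z) \<bullet> i)\<bar>)"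
      by (rule sum.cong) simp_all
    also have "\<dots> \<le> (\<Sum>k\<in>Basis. \<Sum>i\<in>Basis. \<bar>C k i t\<bar> * norm (y - z))"
    proof (rule sum_mono)
      fix k :: 'e
      have "\<bar>\<Sum>i\<in>Basis. C k i t * ((y - z) \<bullet> i)\<bar> \<le> (\<Sum>i\<in>Basis. \<bar>C k i t * ((y - z) \<bullet> i)\<bar>)"
        by (rule sum_abs)
      also have "\<dots> \<le> (\<Sum>i\<in>Basis. \<bar>C k i t\<bar> * norm (y - z))"
        unfolding abs_mult by (intro sum_mono mult_left_mono Basis_le_norm) simp_all
      finally show "\<bar>\<Sum>i\<in>Basis. C k i t * ((y - z) \<bullet> i)\<bar> \<le> (\<Sum>i\<in>Basis. \<bar>C k i t\<bar> * norm (y - z))" .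
    qed
    also have "\<dots> = (\<Sum>k\<in>Basis. \<Sum>i\<in>Basis. \<bar>C k i t\<bar>) * norm (y - z)"
      by (simp add: sum_distrib_right)
    also have "\<dots> \<le> K * norm (y - z)"
      by (rule mult_right_mono[OF K[OF t] norm_ge_zero])
    finally show ?thesis .
  qed
  obtain N' where N': "open N'" "{a..b} \<inter> \<gamma> -` N = {a..b} \<inter> N'"
    using continuous_openin_preimage_gen[OF cont N(1)] by (auto simp: openin_open)
  then have "x \<in> N'" using x N(2) by blast
  then obtain \<delta> where \<delta>: "\<delta> > 0" "ball x \<delta> \<subseteq> N'" using N'(1) open_contains_ball by blast
  \<comment> \<open>short enough for the curve to stay in the frame's domain and for the Picard operator to contract\<close>
  define \<epsilon> where "\<epsilon> = min \<delta> (1 / (2 * (K + 1)))"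
  have "\<epsilon> > 0" using \<delta>(1) Kpos by (simp add: \<epsilon>_def)
  moreover have "transportable A D \<gamma> c d"
    if "a \<le> c \<and> c \<le> x \<and> x \<le> d \<and> d \<le> b \<and> c < d \<and> d - c < \<epsilon>" for c d
  proof -
    have cd: "a \<le> c" "c \<le> x" "x \<le> d" "d \<le> b" "c < d" "d - c < \<epsilon>" using that by auto
    have sub: "{c..d} \<subseteq> {a..b}" using cd by auto
    have inN: "\<gamma> t \<in> N" if t: "t \<in> {c..d}" for t
    proof -
      have "dist x t < \<delta>" using t cd by (auto simp: dist_real_def \<epsilon>_def)
      then have "t \<in> {a..b} \<inter> N'" using \<delta>(2) sub t by auto
      with N'(2) show ?thesis by blast
    qed
    have small: "2 * (K * (d - c)) < 1"
    proof -
      have "(K + 1) * (d - c) < (K + 1) * (1 / (2 * (K + 1)))"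
        using cd(6) Kpos by (intro mult_strict_left_mono) (simp_all add: \<epsilon>_def)
      also have "\<dots> = 1 / 2" using Kpos by (simp add: field_simps)
      finally show ?thesis using cd(5) by (simp add: algebra_simps)
    qed
    show ?thesis
      unfolding transportable_def
    proof (intro ballI)
      fix t1 v assume t1: "t1 \<in> {c..d}" and v: "v \<in> tangent_space A (\<gamma> t1)"
      have Fc: "continuous_on {c..d} (\<lambda>t. F t (y t))" if "continuous_on {c..d} y" for y
        unfolding F_def
        by (intro continuous_on_minus continuous_on_sum continuous_on_scaleR continuous_on_mult
            continuous_on_const continuous_on_inner that continuous_on_subset[OF C_cont sub])
      have "\<exists>y. y t1 = (\<Sum>i\<in>Basis. v (u i) *\<^sub>R i) \<and>
          (\<forall>t\<in>{c..d}. (y has_vector_derivative F t (y t)) (at t within {c..d}))"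
        by (rule short_time_ode_solution[OF t1 Fc F_lip Kpos small]) (use sub in auto)
      then obtain y where y0: "y t1 = (\<Sum>i\<in>Basis. v (u i) *\<^sub>R i)"
        and y: "\<And>t. t \<in> {c..d} \<Longrightarrow> (y has_vector_derivative F t (y t)) (at t within {c..d})"
        by blast
      \<comment> \<open>the initial value of \<open>y\<close> lists the components of \<open>v\<close>, so that \<open>V t1 = v\<close>\<close>
      define V where "V t = (\<Sum>i\<in>Basis. (y t \<bullet> i) *\<^sub>T E i (\<gamma> t))" for t
      have "V t1 = (\<Sum>i\<in>Basis. v (u i) *\<^sub>T E i (\<gamma> t1))"
        unfolding V_def by (rule sum.cong) (simp_all add: y0)
      then have V1: "V t1 = v" using frame[OF inN[OF t1] v] by simp
      have "parallel_along A D c d \<gamma> V"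
      proof (rule parallel_along_piece[OF cd(5) smooth_curve_on_subset[OF \<gamma> sub]])
        fix t assume t: "t \<in> {c..d}"
        have nb: "at t within {c..d} \<noteq> bot" by (rule at_within_Icc_neq_bot[OF cd(5) t])
        have vel: "velocity A {c..d} \<gamma> t = velocity A {a..b} \<gamma> t"
          by (rule velocity_subset[OF \<gamma> sub t nb])
        have "velocity A {c..d} \<gamma> t \<in> tangent_space A (\<gamma> t)"
          by (rule velocity_tangent[OF smooth_curve_on_subset[OF \<gamma> sub] t nb])
        then obtain X where X: "X \<in> vector_fields A" "X (\<gamma> t) = velocity A {c..d} \<gamma> t"
          using tangent_vector_extension by blast
        show "has_covariant_derivative A D {c..d} \<gamma> V 0 t"
        proof (rule has_covariant_derivative_finite[OF finite_Basis E _ _ X])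
          show "((\<lambda>s. y s \<bullet> i) has_real_derivative F t (y t) \<bullet> i) (at t within {c..d})" for i
            using bounded_linear.has_vector_derivative[OF bounded_linear_inner_left y[OF t]]
            by (simp add: has_real_derivative_iff_has_vector_derivative)
          show "V s = (\<Sum>i\<in>Basis. (y s \<bullet> i) *\<^sub>T E i (\<gamma> s))" for s by (rule V_def)
          show "0 = (\<Sum>i\<in>Basis. (F t (y t) \<bullet> i) *\<^sub>T E i (\<gamma> t) + (y t \<bullet> i) *\<^sub>T D X (E i) (\<gamma> t))"
          proof
            fix w
            have F: "F t (y t) \<bullet> k = - (\<Sum>i\<in>Basis. C k i t * (y t \<bullet> i))" if "k \<in> Basis" for k
              using that by (simp add: F_def)
            have "(\<Sum>i\<in>Basis. (y t \<bullet> i) * D X (E i) (\<gamma> t) w) =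
                (\<Sum>i\<in>Basis. \<Sum>k\<in>Basis. C k i t * (y t \<bullet> i) * E k (\<gamma> t) w)"
              using conn[OF X(1) X(2)[unfolded vel] inN[OF t]]
              by (simp add: sum_fun_apply tscale_def sum_distrib_left mult.assoc mult.left_commute)
            also have "\<dots> = (\<Sum>k\<in>Basis. \<Sum>i\<in>Basis. C k i t * (y t \<bullet> i) * E k (\<gamma> t) w)"
              by (rule sum.swap)
            also have "\<dots> = - (\<Sum>k\<in>Basis. (F t (y t) \<bullet> k) * E k (\<gamma> t) w)"
              by (simp add: F sum_distrib_right sum_negf)
            finally show "0 w = (\<Sum>i\<in>Basis. (F t (y t) \<bullet> i) *\<^sub>T E i (\<gamma> t) + (y t \<bullet> i) *\<^sub>T D X (E i) (\<gamma> t)) w"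
              by (simp add: sum_fun_apply tscale_def sum.distrib)
          qed
        qed
      qed
      with V1 show "\<exists>V. parallel_along A D c d \<gamma> V \<and> V t1 = v" by blast
    qed
  qed
  ultimately show ?thesis by blast
qed

text \<open>Starting in one of the two intervals, solve there first and continue into the other interval from the
value at the common end point \<open>m\<close>, which is a tangent vector.\<close>

lemma transportable_trans:
  assumes cm: "c < m" "m < d" and t: "transportable A D \<gamma> c m" "transportable A D \<gamma> m d"
  shows "transportable A D \<gamma> c d"
  unfolding transportable_def
proof (intro ballI)
  fix s v assume s: "s \<in> {c..d}" and v: "v \<in> tangent_space A (\<gamma> s)"
  show "\<exists>Z. parallel_along A D c d \<gamma> Z \<and> Z s = v"
  proof (cases "s \<le> m")
    case True
    then have s1: "s \<in> {c..m}" using s by simp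
    then obtain V where V: "parallel_along A D c m \<gamma> V" "V s = v"
      using t(1) v unfolding transportable_def by blast
    have m: "m \<in> {c..m}" "m \<in> {m..d}" using cm by simp_all
    have "V m \<in> tangent_space A (\<gamma> m)"
      by (rule parallel_along_tangent[OF V(1) cm(1) m(1)])
    then obtain W where W: "parallel_along A D m d \<gamma> W" "W m = V m"
      using t(2) m(2) unfolding transportable_def by blast
    show ?thesis
      using parallel_along_join[OF V(1) W(1) W(2)[symmetric]] V(2) True
      by (intro exI[of _ "\<lambda>t. if t \<le> m then V t else W t"]) simp
  next
    case False
    then have s1: "s \<in> {m..d}" using s by simp
    then obtain W where W: "parallel_along A D m d \<gamma> W" "W s = v"
      using t(2) v unfolding transportable_def by blast
    have m: "m \<in> {c..m}" "m \<in> {m..d}" using cm by simp_all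
    have "W m \<in> tangent_space A (\<gamma> m)"
      by (rule parallel_along_tangent[OF W(1) cm(2) m(2)])
    then obtain V where V: "parallel_along A D c m \<gamma> V" "V m = W m"
      using t(1) m(1) unfolding transportable_def by blast
    show ?thesis
      using parallel_along_join[OF V(1) W(1) V(2)] W(2) False
      by (intro exI[of _ "\<lambda>t. if t \<le> m then V t else W t"]) simp
  qed
qed

text \<open>Short intervals around every point suffice, by bisection, because transportability passes to
unions of adjacent intervals.\<close>

lemma transportable_smooth_piece:
  assumes D: "affine_connection A D" and ab: "a < b" and \<gamma>: "smooth_curve_on A {a..b} \<gamma>"
  shows "transportable A D \<gamma> a b"
proof -
  define P where "P c d \<longleftrightarrow> (a \<le> c \<and> c < d \<and> d \<le> b \<longrightarrow> transportable A D \<gamma> c d)" for c d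
  have "P a b"
  proof (rule Bolzano[OF less_imp_le[OF ab], of P])
    fix c m d assume *: "P c m" "P m d" "c \<le> m" "m \<le> d"
    show "P c d"
    proof (cases "c = m \<or> m = d")
      case True
      with * show ?thesis by blast
    next
      case False
      with * have "c < m" "m < d" by simp_all
      with * show ?thesis
        unfolding P_def using transportable_trans[of c m d D \<gamma>] by simp
    qed
  next
    fix x assume "a \<le> x" "x \<le> b"
    then have "x \<in> {a..b}" by simp
    from transportable_short[OF D ab \<gamma> this]
    show "\<exists>\<delta>>0. \<forall>c d. c \<le> x \<and> x \<le> d \<and> d - c < \<delta> \<longrightarrow> P c d"
      unfolding P_def by blast
  qed
  with ab show ?thesis by (simp add: P_def)
qed

lemma transportable_piecewise_smooth:
  assumes D: "affine_connection A D" and \<gamma>: "piecewise_smooth_curve A a b \<gamma>"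
  shows "transportable A D \<gamma> a b"
proof -
  obtain n \<tau> where p: "smooth_partition A a b \<gamma> n \<tau>" and ab: "a < b"
    using \<gamma> unfolding piecewise_smooth_curve_def by blast
  have ends: "\<tau> 0 = a" "\<tau> n = b" using p by (simp_all add: smooth_partition_def)
  have piece: "\<tau> i < \<tau> (Suc i)" "smooth_curve_on A {\<tau> i..\<tau> (Suc i)} \<gamma>" if "i < n" for i
    using p that by (simp_all add: smooth_partition_def)
  have "transportable A D \<gamma> (\<tau> 0) (\<tau> (Suc k))" if "Suc k \<le> n" for k
    using that
  proof (induction k)
    case 0
    then show ?case
      using piece[of 0] by (intro transportable_smooth_piece[OF D]) simp_all
  next
    case (Suc k)
    have k: "Suc k < n" "0 < n" using Suc.prems by simp_all
    have "\<tau> 0 < \<tau> (Suc 0)" by (rule piece(1)[OF k(2)])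
    also have "\<dots> \<le> \<tau> (Suc k)" using partition_mono[OF p, of "Suc 0" "Suc k"] k by simp
    finally have "\<tau> 0 < \<tau> (Suc k)" .
    moreover have "transportable A D \<gamma> (\<tau> 0) (\<tau> (Suc k))" using Suc by simp
    ultimately show ?case
      using transportable_trans[OF _ piece(1)[OF k(1)] _ transportable_smooth_piece[OF D piece[OF k(1)]]]
      by blast
  qed
  moreover obtain k where "n = Suc k" using ends ab by (cases n) auto
  ultimately show ?thesis using ends by auto
qed

section \<open>Uniqueness of parallel fields by duality\<close>

lemma metric_add_left:
  assumes g: "riemannian_metric A g" and "v \<in> tangent_space A p" "v' \<in> tangent_space A p" "w \<in> tangent_space A p"
  shows "g p (v + v') w = g p v w + g p v' w"
  using assms unfolding riemannian_metric_def by blast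

lemma metric_scale_left:
  assumes g: "riemannian_metric A g" and "v \<in> tangent_space A p" "w \<in> tangent_space A p"
  shows "g p (r *\<^sub>T v) w = r * g p v w"
  using assms unfolding riemannian_metric_def by blast

lemma metric_sym:
  assumes g: "riemannian_metric A g" and "v \<in> tangent_space A p" "w \<in> tangent_space A p"
  shows "g p v w = g p w v"
  using assms unfolding riemannian_metric_def by blast

lemma metric_zero_left:
  assumes g: "riemannian_metric A g" and w: "w \<in> tangent_space A p"
  shows "g p 0 w = 0"
proof -
  have "0 *\<^sub>T (0 :: 'm tvec) = 0" by (simp add: tscale_def fun_eq_iff)
  then show ?thesis
    using metric_scale_left[OF g tangent_zero w, of 0] by simp
qed

lemma metric_sum_left:
  assumes g: "riemannian_metric A g" and v: "\<And>i. i \<in> I \<Longrightarrow> v i \<in> tangent_space A p" and w: "w \<in> tangent_space A p"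
  shows "g p (\<Sum>i\<in>I. r i *\<^sub>T v i) w = (\<Sum>i\<in>I. r i * g p (v i) w)"
  using v
proof (induction I rule: infinite_finite_induct)
  case (insert i I)
  have t: "r i *\<^sub>T v i \<in> tangent_space A p" "(\<Sum>i\<in>I. r i *\<^sub>T v i) \<in> tangent_space A p"
    using insert.prems by (auto intro!: tangent_scale tangent_sum)
  have "g p (r i *\<^sub>T v i) w = r i * g p (v i) w"
    using insert.prems by (intro metric_scale_left[OF g _ w]) simp
  moreover have "g p (\<Sum>i\<in>I. r i *\<^sub>T v i) w = (\<Sum>i\<in>I. r i * g p (v i) w)"
    using insert by blast
  ultimately show ?case
    by (simp only: sum.insert[OF insert.hyps] metric_add_left[OF g t w])
qed (auto intro: metric_zero_left[OF g w])

lemma metric_sum_right: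
  assumes g: "riemannian_metric A g" and v: "\<And>i. i \<in> I \<Longrightarrow> v i \<in> tangent_space A p" and w: "w \<in> tangent_space A p"
  shows "g p w (\<Sum>i\<in>I. r i *\<^sub>T v i) = (\<Sum>i\<in>I. r i * g p w (v i))"
proof -
  have "(\<Sum>i\<in>I. r i *\<^sub>T v i) \<in> tangent_space A p"
    using v by (intro tangent_sum tangent_scale)
  then have "g p w (\<Sum>i\<in>I. r i *\<^sub>T v i) = g p (\<Sum>i\<in>I. r i *\<^sub>T v i) w"
    by (rule metric_sym[OF g w])
  also have "\<dots> = (\<Sum>i\<in>I. r i * g p (v i) w)" by (rule metric_sum_left[OF g v w])
  also have "\<dots> = (\<Sum>i\<in>I. r i * g p w (v i))"
    by (rule sum.cong) (simp_all add: metric_sym[OF g v w])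
  finally show ?thesis .
qed

lemma metric_diff_left:
  assumes g: "riemannian_metric A g" and v: "v \<in> tangent_space A p" "v' \<in> tangent_space A p" and w: "w \<in> tangent_space A p"
  shows "g p (v - v') w = g p v w - g p v' w"
  using metric_add_left[OF g tangent_diff[OF v] v(2) w] by (simp add: algebra_simps)

text \<open>Expand both fields in vector fields on the manifold. The derivative of \<open>g(Y\<^sub>i, Z\<^sub>j)\<close> along the
curve is given by duality for one extension \<open>X\<close> of the velocity; the extension \<open>X'\<close> that comes with
the covariant derivative of \<open>W\<close> may be a different one, and then pointwise dependence of the
connection on \<open>X\<close> identifies the two.\<close>

lemma metric_derivative_along_curve:
  assumes g: "riemannian_metric A g" and D: "affine_connection A D" and Ds: "affine_connection A Ds"
    and dual: "dual_connections A g D Ds"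
    and \<gamma>: "smooth_curve_on A S \<gamma>" and t: "t \<in> S" "at t within S \<noteq> bot"
    and V: "has_covariant_derivative A D S \<gamma> V V' t" and W: "has_covariant_derivative A Ds S \<gamma> W W' t"
  shows "((\<lambda>s. g (\<gamma> s) (V s) (W s)) has_real_derivative g (\<gamma> t) V' (W t) + g (\<gamma> t) (V t) W') (at t within S)"
proof (rule has_covariant_derivativeE[OF V], rule has_covariant_derivativeE[OF W])
  fix n :: nat and Y f f' X \<epsilon> and m :: nat and Z h h' X' \<epsilon>'
  assume Y: "\<And>i. i < n \<Longrightarrow> Y i \<in> vector_fields A"
    and f: "\<And>i. i < n \<Longrightarrow> (f i has_real_derivative f' i) (at t within S)"
    and \<epsilon>: "\<epsilon> > 0" and Veq: "\<And>s. s \<in> S \<Longrightarrow> \<bar>s - t\<bar> < \<epsilon> \<Longrightarrow> V s = (\<Sum>i<n. f i s *\<^sub>T Y i (\<gamma> s))"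
    and X: "X \<in> vector_fields A" "X (\<gamma> t) = velocity A S \<gamma> t"
    and V': "V' = (\<Sum>i<n. f' i *\<^sub>T Y i (\<gamma> t) + f i t *\<^sub>T D X (Y i) (\<gamma> t))"
    and Z: "\<And>i. i < m \<Longrightarrow> Z i \<in> vector_fields A"
    and h: "\<And>i. i < m \<Longrightarrow> (h i has_real_derivative h' i) (at t within S)"
    and \<epsilon>': "\<epsilon>' > 0" and Weq: "\<And>s. s \<in> S \<Longrightarrow> \<bar>s - t\<bar> < \<epsilon>' \<Longrightarrow> W s = (\<Sum>i<m. h i s *\<^sub>T Z i (\<gamma> s))"
    and X': "X' \<in> vector_fields A" "X' (\<gamma> t) = velocity A S \<gamma> t"
    and W': "W' = (\<Sum>i<m. h' i *\<^sub>T Z i (\<gamma> t) + h i t *\<^sub>T Ds X' (Z i) (\<gamma> t))"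
  note tan = vector_field_tangent
  let ?p = "\<gamma> t"
  define G where "G i j p = g p (Y i p) (Z j p)" for i j p
  have G_sm: "G i j \<in> smooth_functions A" if "i < n" "j < m" for i j
    using g Y[OF that(1)] Z[OF that(2)] by (simp add: riemannian_metric_def G_def[abs_def])
  have G_deriv: "((\<lambda>s. G i j (\<gamma> s)) has_real_derivative
      g ?p (D X (Y i) ?p) (Z j ?p) + g ?p (Y i ?p) (Ds X' (Z j) ?p)) (at t within S)" if ij: "i < n" "j < m" for i j
  proof -
    have "act X (\<lambda>p. g p (Y i p) (Z j p)) = (\<lambda>p. g p (D X (Y i) p) (Z j p) + g p (Y i p) (Ds X (Z j) p))"
      using dual X(1) Y[OF ij(1)] Z[OF ij(2)] by (simp add: dual_connections_def)
    then have "X ?p (G i j) = g ?p (D X (Y i) ?p) (Z j ?p) + g ?p (Y i ?p) (Ds X (Z j) ?p)"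
      unfolding G_def[abs_def] by (simp add: act_def fun_eq_iff)
    moreover have "Ds X (Z j) ?p = Ds X' (Z j) ?p"
      using X X' by (intro connection_pointwise[OF Ds X(1) X'(1) Z[OF ij(2)]]) simp
    moreover have "((G i j \<circ> \<gamma>) has_vector_derivative velocity A S \<gamma> t (G i j)) (at t within S)"
      by (rule velocity_derivative[OF \<gamma> t G_sm[OF ij]])
    ultimately show ?thesis
      using X(2) by (simp add: has_real_derivative_iff_has_vector_derivative o_def)
  qed
  have Zsum: "(\<Sum>j<m. h j s *\<^sub>T Z j q) \<in> tangent_space A q" for s q
    using Z by (intro tangent_sum tangent_scale tan) simp
  have Ysum: "(\<Sum>i<n. f i s *\<^sub>T Y i q) \<in> tangent_space A q" for s q
    using Y by (intro tangent_sum tangent_scale tan) simp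
  have expand: "g (\<gamma> s) (V s) (W s) = (\<Sum>i<n. \<Sum>j<m. f i s * h j s * G i j (\<gamma> s))"
    if s: "s \<in> S" "dist s t < min \<epsilon> \<epsilon>'" for s
  proof -
    have "V s = (\<Sum>i<n. f i s *\<^sub>T Y i (\<gamma> s))" "W s = (\<Sum>j<m. h j s *\<^sub>T Z j (\<gamma> s))"
      using s by (auto simp: dist_real_def intro!: Veq Weq)
    then have "g (\<gamma> s) (V s) (W s) = (\<Sum>i<n. f i s * g (\<gamma> s) (Y i (\<gamma> s)) (\<Sum>j<m. h j s *\<^sub>T Z j (\<gamma> s)))"
      using metric_sum_left[OF g tan[OF Y] Zsum, of "{..<n}"] by simp
    also have "\<dots> = (\<Sum>i<n. f i s * (\<Sum>j<m. h j s * G i j (\<gamma> s)))"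
      by (intro sum.cong refl arg_cong2[where f = "(*)"])
         (use metric_sum_right[OF g tan[OF Z] tan[OF Y], of "{..<m}"] in \<open>simp add: G_def\<close>)
    finally show ?thesis by (simp add: sum_distrib_left mult.assoc)
  qed
  define d where "d i j = g ?p (D X (Y i) ?p) (Z j ?p) + g ?p (Y i ?p) (Ds X' (Z j) ?p)" for i j
  have "((\<lambda>s. \<Sum>i<n. \<Sum>j<m. f i s * h j s * G i j (\<gamma> s)) has_real_derivative
     (\<Sum>i<n. \<Sum>j<m. (f' i * h j t + h' j * f i t) * G i j ?p + d i j * (f i t * h j t))) (at t within S)"
    by (intro DERIV_sum DERIV_mult f h G_deriv[folded d_def]) auto
  then have deriv: "((\<lambda>s. g (\<gamma> s) (V s) (W s)) has_real_derivative
     (\<Sum>i<n. \<Sum>j<m. (f' i * h j t + h' j * f i t) * G i j ?p + d i j * (f i t * h j t))) (at t within S)"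
    by (rule has_field_derivative_transform_within[OF _ _ t(1), where d = "min \<epsilon> \<epsilon>'"])
       (use \<epsilon> \<epsilon>' expand in auto)
  have Vt: "V t = (\<Sum>i<n. f i t *\<^sub>T Y i ?p)" and Wt: "W t = (\<Sum>j<m. h j t *\<^sub>T Z j ?p)"
    using Veq[OF t(1)] Weq[OF t(1)] \<epsilon> \<epsilon>' by simp_all
  have DY: "D X (Y i) ?p \<in> tangent_space A ?p" if "i < n" for i
    by (rule tan[OF connection_vector_field[OF D X(1) Y[OF that]]])
  have DZ: "Ds X' (Z j) ?p \<in> tangent_space A ?p" if "j < m" for j
    by (rule tan[OF connection_vector_field[OF Ds X'(1) Z[OF that]]])
  have Wtan: "W t \<in> tangent_space A ?p" unfolding Wt by (rule Zsum)
  have left: "g ?p V' (W t) = (\<Sum>i<n. \<Sum>j<m. f' i * h j t * G i j ?p + f i t * h j t * g ?p (D X (Y i) ?p) (Z j ?p))"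
  proof -
    have V'': "V' = (\<Sum>i<n. f' i *\<^sub>T Y i ?p) + (\<Sum>i<n. f i t *\<^sub>T D X (Y i) ?p)"
      unfolding V' by (rule sum.distrib)
    have "g ?p V' (W t) = g ?p (\<Sum>i<n. f' i *\<^sub>T Y i ?p) (W t) + g ?p (\<Sum>i<n. f i t *\<^sub>T D X (Y i) ?p) (W t)"
      unfolding V'' using Y DY
      by (intro metric_add_left[OF g _ _ Wtan] tangent_sum tangent_scale) (simp_all add: tan)
    also have "g ?p (\<Sum>i<n. f' i *\<^sub>T Y i ?p) (W t) = (\<Sum>i<n. f' i * g ?p (Y i ?p) (W t))"
      by (rule metric_sum_left[OF g _ Wtan]) (simp add: tan Y)
    also have "g ?p (\<Sum>i<n. f i t *\<^sub>T D X (Y i) ?p) (W t) = (\<Sum>i<n. f i t * g ?p (D X (Y i) ?p) (W t))"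
      by (rule metric_sum_left[OF g _ Wtan]) (simp add: DY)
    also have "(\<Sum>i<n. f' i * g ?p (Y i ?p) (W t)) = (\<Sum>i<n. f' i * (\<Sum>j<m. h j t * G i j ?p))"
      unfolding Wt G_def
      by (intro sum.cong refl arg_cong2[where f = "(*)"] metric_sum_right[OF g]) (simp_all add: tan Y Z)
    also have "(\<Sum>i<n. f i t * g ?p (D X (Y i) ?p) (W t)) =
        (\<Sum>i<n. f i t * (\<Sum>j<m. h j t * g ?p (D X (Y i) ?p) (Z j ?p)))"
      unfolding Wt
      by (intro sum.cong refl arg_cong2[where f = "(*)"] metric_sum_right[OF g]) (simp_all add: tan DY Z)
    finally show ?thesis by (simp add: sum_distrib_left sum.distrib mult.assoc)
  qed
  have right: "g ?p (V t) W' = (\<Sum>i<n. \<Sum>j<m. h' j * f i t * G i j ?p + f i t * h j t * g ?p (Y i ?p) (Ds X' (Z j) ?p))"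
  proof -
    have W'': "W' = (\<Sum>j<m. h' j *\<^sub>T Z j ?p) + (\<Sum>j<m. h j t *\<^sub>T Ds X' (Z j) ?p)"
      unfolding W' by (rule sum.distrib)
    have t1: "(\<Sum>j<m. h' j *\<^sub>T Z j ?p) \<in> tangent_space A ?p" and t2: "(\<Sum>j<m. h j t *\<^sub>T Ds X' (Z j) ?p) \<in> tangent_space A ?p"
      by (intro tangent_sum tangent_scale; simp add: tan Z DZ)+
    have "g ?p (Y i ?p) W' = (\<Sum>j<m. h' j * G i j ?p) + (\<Sum>j<m. h j t * g ?p (Y i ?p) (Ds X' (Z j) ?p))" if i: "i < n" for i
    proof -
      have "g ?p (Y i ?p) W' = g ?p (Y i ?p) (\<Sum>j<m. h' j *\<^sub>T Z j ?p) + g ?p (Y i ?p) (\<Sum>j<m. h j t *\<^sub>T Ds X' (Z j) ?p)"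
        unfolding W'' using metric_add_left[OF g t1 t2 tan[OF Y[OF i]]]
        by (simp only: metric_sym[OF g tan[OF Y[OF i]] t1] metric_sym[OF g tan[OF Y[OF i]] t2]
              metric_sym[OF g tan[OF Y[OF i]] tangent_add[OF t1 t2]])
      also have "g ?p (Y i ?p) (\<Sum>j<m. h' j *\<^sub>T Z j ?p) = (\<Sum>j<m. h' j * G i j ?p)"
        unfolding G_def by (rule metric_sum_right[OF g]) (simp_all add: tan Y[OF i] Z)
      also have "g ?p (Y i ?p) (\<Sum>j<m. h j t *\<^sub>T Ds X' (Z j) ?p) = (\<Sum>j<m. h j t * g ?p (Y i ?p) (Ds X' (Z j) ?p))"
        by (rule metric_sum_right[OF g]) (simp_all add: tan Y[OF i] DZ)
      finally show ?thesis .
    qed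
    moreover have "g ?p (V t) W' = (\<Sum>i<n. f i t * g ?p (Y i ?p) W')"
      unfolding Vt W'' by (rule metric_sum_left[OF g _ tangent_add[OF t1 t2]]) (simp add: tan Y)
    ultimately show ?thesis
      by (simp add: sum_distrib_left sum.distrib distrib_left mult.assoc mult.left_commute)
  qed
  have "g ?p V' (W t) + g ?p (V t) W' =
     (\<Sum>i<n. \<Sum>j<m. (f' i * h j t + h' j * f i t) * G i j ?p + d i j * (f i t * h j t))"
    unfolding left right d_def sum.distrib[symmetric]
    by (intro sum.cong refl) (simp add: algebra_simps)
  with deriv show ?thesis by simp
qed

text \<open>The two fields may come with different partitions. On an interval contained in a piece of each
of them the derivative of the product vanishes; such intervals exist to the left and to the right of
every point, and bisection extends the constancy to the whole interval.\<close>

lemma dual_parallel_constant: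
  assumes g: "riemannian_metric A g" and D: "affine_connection A D" and Ds: "affine_connection A Ds"
    and dual: "dual_connections A g D Ds"
    and V: "parallel_along A D a b \<gamma> V" and W: "parallel_along A Ds a b \<gamma> W"
    and st: "a \<le> s" "s \<le> t" "t \<le> b" and ab: "a < b"
  shows "g (\<gamma> s) (V s) (W s) = g (\<gamma> t) (V t) (W t)"
proof -
  let ?F = "\<lambda>s. g (\<gamma> s) (V s) (W s)"
  have piece: "?F c = ?F d"
    if cd: "c < d" and sub: "{c..d} \<subseteq> {l..r}" "{c..d} \<subseteq> {l'..r'}"
      and \<gamma>: "smooth_curve_on A {l..r} \<gamma>" "smooth_curve_on A {l'..r'} \<gamma>"
      and cV: "\<And>t. t \<in> {l..r} \<Longrightarrow> has_covariant_derivative A D {l..r} \<gamma> V 0 t"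
      and cW: "\<And>t. t \<in> {l'..r'} \<Longrightarrow> has_covariant_derivative A Ds {l'..r'} \<gamma> W 0 t" for c d l r l' r'
  proof -
    have "(?F has_derivative (\<lambda>_. 0)) (at x within {c..d})" if x: "x \<in> {c..d}" for x
    proof -
      have nb: "at x within {c..d} \<noteq> bot" by (rule at_within_Icc_neq_bot[OF cd x])
      have V0: "has_covariant_derivative A D {c..d} \<gamma> V 0 x"
        by (rule has_covariant_derivative_subset[OF cV \<gamma>(1) sub(1) x nb]) (use x sub in blast)
      have W0: "has_covariant_derivative A Ds {c..d} \<gamma> W 0 x"
        by (rule has_covariant_derivative_subset[OF cW \<gamma>(2) sub(2) x nb]) (use x sub in blast)
      have V1: "parallel_along A D c d \<gamma> V"
        using has_covariant_derivative_subset[OF cV \<gamma>(1) sub(1)] sub(1) at_within_Icc_neq_bot[OF cd]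
        by (intro parallel_along_piece[OF cd smooth_curve_on_subset[OF \<gamma>(1) sub(1)]]) blast
      have W1: "parallel_along A Ds c d \<gamma> W"
        using has_covariant_derivative_subset[OF cW \<gamma>(2) sub(2)] sub(2) at_within_Icc_neq_bot[OF cd]
        by (intro parallel_along_piece[OF cd smooth_curve_on_subset[OF \<gamma>(2) sub(2)]]) blast
      note Vt = parallel_along_tangent[OF V1 cd x] and Wt = parallel_along_tangent[OF W1 cd x]
      have "(?F has_real_derivative g (\<gamma> x) 0 (W x) + g (\<gamma> x) (V x) 0) (at x within {c..d})"
        by (rule metric_derivative_along_curve[OF g D Ds dual smooth_curve_on_subset[OF \<gamma>(1) sub(1)] x nb V0 W0])
      moreover have "g (\<gamma> x) 0 (W x) = 0" by (rule metric_zero_left[OF g Wt])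
      moreover have "g (\<gamma> x) (V x) 0 = 0"
        using metric_zero_left[OF g Vt] metric_sym[OF g Vt tangent_zero] by simp
      moreover have "(*) (0::real) = (\<lambda>_. 0)" by (simp add: fun_eq_iff)
      ultimately show ?thesis by (simp add: has_field_derivative_def)
    qed
    then obtain k where "\<And>x. x \<in> {c..d} \<Longrightarrow> ?F x = k"
      using has_derivative_zero_constant[of "{c..d}" ?F] by auto
    then show ?thesis using cd by simp
  qed
  have right: "\<exists>\<delta>>0. \<forall>d. x < d \<and> d < x + \<delta> \<longrightarrow> ?F x = ?F d" if x: "a \<le> x" "x < b" for x
  proof -
    obtain l r where V': "l \<le> x" "x < r" "smooth_curve_on A {l..r} \<gamma>"
      "\<forall>t\<in>{l..r}. has_covariant_derivative A D {l..r} \<gamma> V 0 t"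
      using parallel_along_right[OF V x] by (elim exE conjE)
    obtain l' r' where W': "l' \<le> x" "x < r'" "smooth_curve_on A {l'..r'} \<gamma>"
      "\<forall>t\<in>{l'..r'}. has_covariant_derivative A Ds {l'..r'} \<gamma> W 0 t"
      using parallel_along_right[OF W x] by (elim exE conjE)
    have "?F x = ?F d" if "x < d \<and> d < x + (min r r' - x)" for d
      by (rule piece[of x d l r l' r']) (use that V' W' in auto)
    moreover have "min r r' - x > 0" using V' W' by simp
    ultimately show ?thesis by blast
  qed
  have left: "\<exists>\<delta>>0. \<forall>c. x - \<delta> < c \<and> c < x \<longrightarrow> ?F c = ?F x" if x: "a < x" "x \<le> b" for x
  proof -
    obtain l r where V': "l < x" "x \<le> r" "smooth_curve_on A {l..r} \<gamma>"
      "\<forall>t\<in>{l..r}. has_covariant_derivative A D {l..r} \<gamma> V 0 t"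
      using parallel_along_left[OF V x] by (elim exE conjE)
    obtain l' r' where W': "l' < x" "x \<le> r'" "smooth_curve_on A {l'..r'} \<gamma>"
      "\<forall>t\<in>{l'..r'}. has_covariant_derivative A Ds {l'..r'} \<gamma> W 0 t"
      using parallel_along_left[OF W x] by (elim exE conjE)
    have "?F c = ?F x" if "x - (x - max l l') < c \<and> c < x" for c
      by (rule piece[of c x l r l' r']) (use that V' W' in auto)
    moreover have "x - max l l' > 0" using V' W' by simp
    ultimately show ?thesis by blast
  qed
  define P where "P c d \<longleftrightarrow> (s \<le> c \<and> d \<le> t \<longrightarrow> ?F c = ?F d)" for c d
  have "P s t"
  proof (rule Bolzano[OF st(2), of P])
    fix c m d assume "P c m" "P m d" "c \<le> m" "m \<le> d"
    then show "P c d" by (simp add: P_def)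
  next
    fix x assume "s \<le> x" "x \<le> t"
    then have x: "a \<le> x" "x \<le> b" using st by simp_all
    have "\<exists>\<delta>>0. \<forall>d. x < d \<and> d \<le> b \<and> d < x + \<delta> \<longrightarrow> ?F x = ?F d"
    proof (cases "x < b")
      case True
      with right[OF x(1)] show ?thesis by blast
    qed (auto intro: exI[of _ 1])
    then obtain \<delta> where \<delta>: "\<delta> > 0" "\<forall>d. x < d \<and> d \<le> b \<and> d < x + \<delta> \<longrightarrow> ?F x = ?F d" by blast
    have "\<exists>\<delta>>0. \<forall>c. x - \<delta> < c \<and> a \<le> c \<and> c < x \<longrightarrow> ?F c = ?F x"
    proof (cases "a < x")
      case True
      with left[OF _ x(2)] show ?thesis by blast
    qed (auto intro: exI[of _ 1])
    then obtain \<delta>' where \<delta>': "\<delta>' > 0" "\<forall>c. x - \<delta>' < c \<and> a \<le> c \<and> c < x \<longrightarrow> ?F c = ?F x" by blast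
    have "P c d" if cd: "c \<le> x \<and> x \<le> d \<and> d - c < min \<delta> \<delta>'" for c d
      unfolding P_def
    proof
      assume b: "s \<le> c \<and> d \<le> t"
      have "?F c = ?F x"
      proof (cases "c = x")
        case False
        then have "x - \<delta>' < c \<and> a \<le> c \<and> c < x" using cd b st by auto
        with \<delta>'(2) show ?thesis by blast
      qed simp
      also have "?F x = ?F d"
      proof (cases "x = d")
        case False
        then have "x < d \<and> d \<le> b \<and> d < x + \<delta>" using cd b st by auto
        with \<delta>(2) show ?thesis by blast
      qed simp
      finally show "?F c = ?F d" .
    qed
    moreover have "min \<delta> \<delta>' > 0" using \<delta>(1) \<delta>'(1) by simp
    ultimately show "\<exists>\<delta>>0. \<forall>c d. c \<le> x \<and> x \<le> d \<and> d - c < \<delta> \<longrightarrow> P c d" by blast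
  qed
  then show ?thesis by (simp add: P_def)
qed

text \<open>By symmetry of duality, uniqueness holds for both connections, each time from existence for the
other one.\<close>

lemma dual_connections_sym:
  assumes g: "riemannian_metric A g" and D: "affine_connection A D" and Ds: "affine_connection A Ds"
    and dual: "dual_connections A g D Ds"
  shows "dual_connections A g Ds D"
  unfolding dual_connections_def
proof (intro ballI)
  fix X Y Z assume XYZ: "X \<in> vector_fields A" "Y \<in> vector_fields A" "Z \<in> vector_fields A"
  note tan = vector_field_tangent
  have "act X (\<lambda>p. g p (Z p) (Y p)) = (\<lambda>p. g p (D X Z p) (Y p) + g p (Z p) (Ds X Y p))"
    using dual XYZ by (simp add: dual_connections_def)
  moreover have "g p (Z p) (Y p) = g p (Y p) (Z p)" for p
    by (rule metric_sym[OF g tan[OF XYZ(3)] tan[OF XYZ(2)]])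
  moreover have "g p (D X Z p) (Y p) = g p (Y p) (D X Z p)" for p
    by (rule metric_sym[OF g tan[OF connection_vector_field[OF D XYZ(1,3)]] tan[OF XYZ(2)]])
  moreover have "g p (Z p) (Ds X Y p) = g p (Ds X Y p) (Z p)" for p
    by (rule metric_sym[OF g tan[OF XYZ(3)] tan[OF connection_vector_field[OF Ds XYZ(1,2)]]])
  ultimately show "act X (\<lambda>p. g p (Y p) (Z p)) = (\<lambda>p. g p (Ds X Y p) (Z p) + g p (Y p) (D X Z p))"
    by (simp add: add.commute)
qed

text \<open>Test \<open>V t - V' t\<close> against the \<open>\<nabla>\<^sup>*\<close>-parallel field through this very vector at time \<open>t\<close>: the product
is the same as at time \<open>s\<close>, where it vanishes.\<close>

lemma parallel_unique:
  assumes g: "riemannian_metric A g" and D: "affine_connection A D" and Ds: "affine_connection A Ds"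
    and dual: "dual_connections A g D Ds" and \<gamma>: "piecewise_smooth_curve A a b \<gamma>"
    and V: "parallel_along A D a b \<gamma> V" "parallel_along A D a b \<gamma> V'" and s: "s \<in> {a..b}" and t: "t \<in> {a..b}"
    and eq: "V s = V' s"
  shows "V t = V' t"
proof (rule ccontr)
  assume ne: "V t \<noteq> V' t"
  have ab: "a < b" using \<gamma> by (simp add: piecewise_smooth_curve_def)
  have Vt: "V t \<in> tangent_space A (\<gamma> t)" "V' t \<in> tangent_space A (\<gamma> t)"
    by (rule parallel_along_tangent[OF V(1) ab t], rule parallel_along_tangent[OF V(2) ab t])
  \<comment> \<open>the vector to be shown to vanish serves as the final value of the dual field\<close>
  let ?w = "V t - V' t"
  have w: "?w \<in> tangent_space A (\<gamma> t)" by (rule tangent_diff[OF Vt])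
  then obtain W where W: "parallel_along A Ds a b \<gamma> W" "W t = ?w"
    using transportable_piecewise_smooth[OF Ds \<gamma>] t unfolding transportable_def by blast
  have const: "g (\<gamma> s) (U s) (W s) = g (\<gamma> t) (U t) (W t)" if "parallel_along A D a b \<gamma> U" for U
  proof (cases "s \<le> t")
    case True
    then show ?thesis
      using s t by (intro dual_parallel_constant[OF g D Ds dual that W(1) _ _ _ ab]) auto
  next
    case False
    then show ?thesis
      using s t by (intro dual_parallel_constant[OF g D Ds dual that W(1) _ _ _ ab, symmetric]) auto
  qed
  have "g (\<gamma> t) (V t) ?w = g (\<gamma> t) (V' t) ?w"
    using const[OF V(1)] const[OF V(2)] eq W(2) by simp
  then have "g (\<gamma> t) ?w ?w = 0"
    using metric_diff_left[OF g Vt w] by simp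
  moreover have "?w \<noteq> 0" using ne by simp
  then have "g (\<gamma> t) ?w ?w > 0"
    using g w unfolding riemannian_metric_def by blast
  ultimately show False by simp
qed

lemma parallel_transport_eq:
  assumes g: "riemannian_metric A g" and D: "affine_connection A D" and Ds: "affine_connection A Ds"
    and dual: "dual_connections A g D Ds" and \<gamma>: "piecewise_smooth_curve A a b \<gamma>"
    and V: "parallel_along A D a b \<gamma> V" and s: "s \<in> {a..b}" and t: "t \<in> {a..b}"
  shows "parallel_transport A D a b \<gamma> s t (V s) = V t"
  unfolding parallel_transport_def
proof (rule the_equality)
  show "\<exists>U. parallel_along A D a b \<gamma> U \<and> U s = V s \<and> U t = V t" using V by blast
  fix w assume "\<exists>U. parallel_along A D a b \<gamma> U \<and> U s = V s \<and> U t = w"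
  then obtain U where "parallel_along A D a b \<gamma> U" "U s = V s" "U t = w" by blast
  then show "w = V t"
    using parallel_unique[OF g D Ds dual \<gamma> _ V s t, of U] by simp
qed

section \<open>Gauge tensors map parallel fields to parallel fields\<close>

lemma tensor_sum:
  assumes \<Theta>: "tensor_field11 A \<Theta>" and v: "\<And>i. i \<in> I \<Longrightarrow> v i \<in> tangent_space A p"
  shows "\<Theta> p (\<Sum>i\<in>I. v i) = (\<Sum>i\<in>I. \<Theta> p (v i))"
proof -
  have add: "\<Theta> p (v + w) = \<Theta> p v + \<Theta> p w" if "v \<in> tangent_space A p" "w \<in> tangent_space A p" for v w
    using \<Theta> that unfolding tensor_field11_def by blast
  have zero: "\<Theta> p 0 = 0"
    using add[OF tangent_zero tangent_zero] by simp
  show ?thesis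
    using v
  proof (induction I rule: infinite_finite_induct)
    case (insert i I)
    have "v i \<in> tangent_space A p" "(\<Sum>i\<in>I. v i) \<in> tangent_space A p"
      using insert.prems by (auto intro: tangent_sum)
    moreover have "\<Theta> p (\<Sum>i\<in>I. v i) = (\<Sum>i\<in>I. \<Theta> p (v i))" using insert by blast
    ultimately show ?case
      by (simp only: sum.insert[OF insert.hyps] add)
  qed (simp_all add: zero)
qed

lemma tensor_scale:
  assumes "tensor_field11 A \<Theta>" and "v \<in> tangent_space A p"
  shows "\<Theta> p (r *\<^sub>T v) = r *\<^sub>T \<Theta> p v"
  using assms unfolding tensor_field11_def by blast

text \<open>The image of a representation \<open>V = \<Sum> f\<^sub>i (Y\<^sub>i \<circ> \<gamma>)\<close> under \<open>\<Theta>\<close> is a representation of \<open>\<Theta>V\<close> with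
the same coefficients, and the gauge equation compares the derivatives of the fields.\<close>

lemma gauge_covariant_derivative:
  assumes Ds: "affine_connection A Ds" and \<Theta>: "statistical_gauge_tensor A D Ds \<Theta>"
    and V: "has_covariant_derivative A Ds S \<gamma> V w t"
  shows "has_covariant_derivative A D S \<gamma> (\<lambda>s. \<Theta> (\<gamma> s) (V s)) (\<Theta> (\<gamma> t) w) t"
proof (rule has_covariant_derivativeE[OF V])
  fix n :: nat and Y f f' X \<epsilon>
  assume Y: "\<And>i. i < n \<Longrightarrow> Y i \<in> vector_fields A"
    and f: "\<And>i. i < n \<Longrightarrow> (f i has_real_derivative f' i) (at t within S)"
    and \<epsilon>: "\<epsilon> > 0" and Veq: "\<And>s. s \<in> S \<Longrightarrow> \<bar>s - t\<bar> < \<epsilon> \<Longrightarrow> V s = (\<Sum>i<n. f i s *\<^sub>T Y i (\<gamma> s))"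
    and X: "X \<in> vector_fields A" "X (\<gamma> t) = velocity A S \<gamma> t"
    and w: "w = (\<Sum>i<n. f' i *\<^sub>T Y i (\<gamma> t) + f i t *\<^sub>T Ds X (Y i) (\<gamma> t))"
  have T: "tensor_field11 A \<Theta>" using \<Theta> by (simp add: statistical_gauge_tensor_def)
  note tan = vector_field_tangent
  have DsY: "Ds X (Y i) p \<in> tangent_space A p" if "i < n" for i p
    by (rule tan[OF connection_vector_field[OF Ds X(1) Y[OF that]]])
  have gauge: "D X (tapply \<Theta> (Y i)) p = \<Theta> p (Ds X (Y i) p)" if "i < n" for i p
  proof -
    have "D X (tapply \<Theta> (Y i)) = tapply \<Theta> (Ds X (Y i))"
      using \<Theta> X(1) Y[OF that] by (simp add: statistical_gauge_tensor_def)
    then show ?thesis by (simp add: tapply_def)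
  qed
  show ?thesis
    unfolding has_covariant_derivative_def
  proof (intro exI[of _ n] exI[of _ "\<lambda>i. tapply \<Theta> (Y i)"] exI[of _ f] exI[of _ f'] exI[of _ X] conjI)
    show "\<forall>i<n. tapply \<Theta> (Y i) \<in> vector_fields A \<and> (f i has_real_derivative f' i) (at t within S)"
      using T Y f by (simp add: tensor_field11_def)
    have "\<Theta> (\<gamma> s) (V s) = (\<Sum>i<n. f i s *\<^sub>T tapply \<Theta> (Y i) (\<gamma> s))" if "s \<in> S" "\<bar>s - t\<bar> < \<epsilon>" for s
    proof -
      have "\<Theta> (\<gamma> s) (V s) = (\<Sum>i<n. \<Theta> (\<gamma> s) (f i s *\<^sub>T Y i (\<gamma> s)))"
        unfolding Veq[OF that] using Y by (intro tensor_sum[OF T] tangent_scale tan) simp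
      also have "\<dots> = (\<Sum>i<n. f i s *\<^sub>T tapply \<Theta> (Y i) (\<gamma> s))"
        unfolding tapply_def using Y by (intro sum.cong refl tensor_scale[OF T] tan) simp
      finally show ?thesis .
    qed
    with \<epsilon> show "\<exists>\<epsilon>>0. \<forall>s\<in>S. \<bar>s - t\<bar> < \<epsilon> \<longrightarrow>
        \<Theta> (\<gamma> s) (V s) = (\<Sum>i<n. f i s *\<^sub>T tapply \<Theta> (Y i) (\<gamma> s))" by blast
    have "\<Theta> (\<gamma> t) w = (\<Sum>i<n. \<Theta> (\<gamma> t) (f' i *\<^sub>T Y i (\<gamma> t) + f i t *\<^sub>T Ds X (Y i) (\<gamma> t)))"
      unfolding w using Y DsY
      by (intro tensor_sum[OF T] tangent_add tangent_scale) (simp_all add: tan)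
    also have "\<dots> = (\<Sum>i<n. f' i *\<^sub>T tapply \<Theta> (Y i) (\<gamma> t) + f i t *\<^sub>T D X (tapply \<Theta> (Y i)) (\<gamma> t))"
    proof (rule sum.cong)
      fix i assume "i \<in> {..<n}"
      then have i: "i < n" by simp
      have "\<Theta> (\<gamma> t) (f' i *\<^sub>T Y i (\<gamma> t) + f i t *\<^sub>T Ds X (Y i) (\<gamma> t)) =
          \<Theta> (\<gamma> t) (f' i *\<^sub>T Y i (\<gamma> t)) + \<Theta> (\<gamma> t) (f i t *\<^sub>T Ds X (Y i) (\<gamma> t))"
        using T tangent_scale[OF tan[OF Y[OF i]]] tangent_scale[OF DsY[OF i]]
        unfolding tensor_field11_def by blast
      then show "\<Theta> (\<gamma> t) (f' i *\<^sub>T Y i (\<gamma> t) + f i t *\<^sub>T Ds X (Y i) (\<gamma> t)) =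
          f' i *\<^sub>T tapply \<Theta> (Y i) (\<gamma> t) + f i t *\<^sub>T D X (tapply \<Theta> (Y i)) (\<gamma> t)"
        by (simp only: tensor_scale[OF T tan[OF Y[OF i]]] tensor_scale[OF T DsY[OF i]] gauge[OF i])
           (simp only: tapply_def)
    qed simp
    finally show "\<Theta> (\<gamma> t) w = (\<Sum>i<n. f' i *\<^sub>T tapply \<Theta> (Y i) (\<gamma> t) + f i t *\<^sub>T D X (tapply \<Theta> (Y i)) (\<gamma> t))" .
  qed (rule X)+
qed

lemma gauge_parallel:
  assumes Ds: "affine_connection A Ds" and \<Theta>: "statistical_gauge_tensor A D Ds \<Theta>"
    and V: "parallel_along A Ds a b \<gamma> V"
  shows "parallel_along A D a b \<gamma> (\<lambda>s. \<Theta> (\<gamma> s) (V s))"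
proof (rule parallel_alongE[OF V])
  fix n \<tau>
  assume p: "smooth_partition A a b \<gamma> n \<tau>"
    and h: "\<And>i t. i < n \<Longrightarrow> t \<in> {\<tau> i..\<tau> (Suc i)} \<Longrightarrow> has_covariant_derivative A Ds {\<tau> i..\<tau> (Suc i)} \<gamma> V 0 t"
  have "\<Theta> q 0 = 0" for q
    using tensor_sum[of \<Theta> "{}" "\<lambda>_. 0" q] \<Theta> by (simp add: statistical_gauge_tensor_def)
  then have "has_covariant_derivative A D {\<tau> i..\<tau> (Suc i)} \<gamma> (\<lambda>s. \<Theta> (\<gamma> s) (V s)) 0 t"
    if "i < n" "t \<in> {\<tau> i..\<tau> (Suc i)}" for i t
    using gauge_covariant_derivative[OF Ds \<Theta> h[OF that]] by simp
  with p show ?thesis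
    unfolding parallel_along_def by blast
qed

end

theorem theorem2p2:
  fixes A :: "('m::{t2_space, second_countable_topology}, 'e::euclidean_space) chart set"
    and g :: "'m metric_tensor"
    and D Ds :: "'m connection"
    and \<Theta> :: "'m tensor11"
  assumes "theta_statistical_manifold A g D Ds \<Theta>"
  shows "\<forall>a b \<gamma>. piecewise_smooth_curve A a b \<gamma> \<longrightarrow>
    (\<forall>s\<in>{a..b}. \<forall>t\<in>{a..b}. \<forall>v\<in>tangent_space A (\<gamma> s).
       (parallel_transport A D a b \<gamma> s t \<circ> \<Theta> (\<gamma> s)) v =
       (\<Theta> (\<gamma> t) \<circ> parallel_transport A Ds a b \<gamma> s t) v)"
proof (intro allI impI ballI)
  fix a b \<gamma> s t v
  assume \<gamma>: "piecewise_smooth_curve A a b \<gamma>" and s: "s \<in> {a..b}" and t: "t \<in> {a..b}"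
    and v: "v \<in> tangent_space A (\<gamma> s)"
  have mfd: "smooth_manifold A" and g: "riemannian_metric A g"
    and D: "affine_connection A D" and Ds: "affine_connection A Ds"
    and dual: "dual_connections A g D Ds" and \<Theta>: "statistical_gauge_tensor A D Ds \<Theta>"
    using assms by (simp_all add: theta_statistical_manifold_def statistical_manifold_def)
  note dual' = dual_connections_sym[OF mfd g D Ds dual]
  obtain V where V: "parallel_along A Ds a b \<gamma> V" "V s = v"
    using transportable_piecewise_smooth[OF mfd Ds \<gamma>] s v unfolding transportable_def by blast
  have "parallel_transport A Ds a b \<gamma> s t v = V t"
    using parallel_transport_eq[OF mfd g Ds D dual' \<gamma> V(1) s t] V(2) by simp
  moreover have "parallel_transport A D a b \<gamma> s t (\<Theta> (\<gamma> s) v) = \<Theta> (\<gamma> t) (V t)"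
    using parallel_transport_eq[OF mfd g D Ds dual \<gamma> gauge_parallel[OF mfd Ds \<Theta> V(1)] s t] V(2) by simp
  ultimately show "(parallel_transport A D a b \<gamma> s t \<circ> \<Theta> (\<gamma> s)) v =
       (\<Theta> (\<gamma> t) \<circ> parallel_transport A Ds a b \<gamma> s t) v"
    by simp
qed

end
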